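(* For both types of exploration (non-backtracking and backtracking) and each $k\in\mathbb{N}$: (a) If $G_n$ converges locally in probability to $(G_\infty,\phi)$ as $n\to\infty$, then $\mu_n^{(k)}$ converges weakly to $\mu_\infty^{(k)}$ in probability as $n\to\infty$. In particular, for every Borel set $A\subseteq\mathbb{R}$, as $n\to\infty$, $\mu_n^{(k)}(A)\to\mu_\infty^{(k)}(A)$ in probability and $\tilde\mu_n^{(k)}(A)\to\mu_\infty^{(k)}(A)$. (b) If $G_n$ converges locally weakly to $(G_\infty,\phi)$ as $n\to\infty$, then $\tilde\mu_n^{(k)}$ converges weakly to $\mu_\infty^{(k)}$ as $n\to\infty$. In particular, for every Borel set $A\subseteq\mathbb{R}$, $\tilde\mu_n^{(k)}(A)\to\mu_\infty^{(k)}(A)$ as $n\to\infty$.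
   Context: Graphs are undirected, simple or multi-graphs; $A^{(G)}_{i,j}$ is the number of edges connecting $i,j$ and $d_i^{(G)}$ the degree of $i$ in $G$. Finite graphs. $G_n$ is a random graph with vertex set $[n]=\{1,\dots,n\}$ on a probability space $(\Omega_n,\mathcal F_n,\mathbb P_n)$, with expectation $\mathbb E_n$. - Non-backtracking exploration: $G_n$ is simple, $n\ge3$, with minimum degree at least $2$. $P_n^{(k)}(i,j)=\sum \big(d_{i}^{(G_n)}\prod_{l=1}^{k-1}(d_{i_l}^{(G_n)}-1)\big)^{-1}$, the sum over all $(i_0,\dots,i_k)\in[n]^{k+1}$ with $i_0=i$, $i_k=j$, $\{i_l,i_{l+1}\}\in E(G_n)$ for $0\le l\le k-1$, and $i_{l-1}\ne i_{l+1}$ for $1\le l\le k-1$ (empty sum $0$, empty product $1$). - Backtracking exploration: $G_n$ is without self-loops and isolated vertices, $n\ge2$; $P_n^{(k)}=P_n^k$ is the $k$-th matrix power of $P_n(i,j)=A^{(G_n)}_{i,j}/d_i^{(G_n)}$. The $k$-level friendship bias is $\Delta_{i,n}^{(k)}=\sum_{j\in[n]}P_n^{(k)}(i,j)d_j^{(G_n)}-d_i^{(G_n)}$; $\mu_n^{(k)}=\frac1n\sum_{i\in[n]}\delta_{\Delta_{i,n}^{(k)}}$ is the quenched empirical distribution (a random measure; $\delta_x$ is the Dirac measure at $x$), and $\tilde\mu_n^{(k)}(\cdot)=\mathbb E_n[\mu_n^{(k)}(\cdot)]$ the annealed one. Limit tree. $(G_\infty,\phi)$ is an almost surely locally finite rooted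 random tree with root $\phi$ and law $\bar\Lambda$; $\mathbb E_{\bar\Lambda}$ is expectation with respect to $(G_\infty,\phi)$. - Non-backtracking exploration: the tree is infinite and every vertex has at least one offspring; the walk starts at $\phi$ and at each step moves to a uniformly chosen offspring of its current position. - Backtracking exploration: the tree is non-trivial (more than one vertex); the walk starts at $\phi$ and at each step moves to a uniformly chosen neighbour of its current position. $P^k(\phi,j)$ is the probability, given the tree, that the walk is at $j$ after $k$ steps; $\Delta_\phi^{(k)}=\sum_{j\in V(G_\infty)}P^k(\phi,j)\,d_j^{(G_\infty)}-d_\phi$, where $d_\phi=d_\phi^{(G_\infty)}$ is the degree of the root; $\mu_\infty^{(k)}$ is the law of $\Delta_\phi^{(k)}$. Local convergence. For a rooted graph $(H,o)$, $B_r^{(H)}(o)$ is the rooted subgraph with root $o$ whose vertices are those at graph distance $\le r$ from $o$ and whose edges are all edges of $H$ between such vertices. $\mathscr G$ is the set of connected locally finite rooted graphs, up to rooted isomorphism, with metric $\mathrm d_{\mathscr G}((H_1,o_1),(H_2,o_2))=\big(1+\sup\{r\ge0: B_r^{(H_1)}(o_1)\simeq B_r^{(H_2)}(o_2)\}\big)^{-1}$. $\mathscr C(G_n,i)$ is the connected component of $i$ in $G_n$, rooted at $i$; $U_n$ is uniform on $[n]$. $G_n$ converges locally weakly to $(G_\infty,\phi)$ with law $\bar\Lambda$ if $\mathbb E[h(\mathscr C(G_n,U_n))]\to\mathbb E_{\bar\Lambda}[h((G_\infty,\phi))]$ (expectation over $G_n$ and $U_n$) for every bounded continuous $h:\mathscr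 G\to\mathbb R$; it converges locally in probability if $\frac1n\sum_{i\in[n]}h(\mathscr C(G_n,i))\to\mathbb E_{\bar\Lambda}[h((G_\infty,\phi))]$ in probability for every such $h$. Under local weak convergence the law $\bar\Lambda$ is necessarily deterministic; under local convergence in probability $\bar\Lambda$ may depend on the realisation of $(G_n)$, so that the limiting law may itself be random. Weak convergence in probability of random measures $\nu_n$ to $\nu$ means $\int f\,d\nu_n\to\int f\,d\nu$ in probability for every bounded continuous $f:\mathbb R\to\mathbb R$.
   Formalization: In (a), when the limiting law is itself random, the annealed masses μ̃_n(A) are shown to converge to the expectation of the random number μ_∞(A), since convergence to the random μ_∞(A) itself is false; for a deterministic limit law the claim is as stated. *)

theory Defs
  imports "HOL-Probability.Probability"
begin

subsection \<open>Rooted graphs\<close>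

text \<open>
  An undirected multigraph is given by its vertex set and its symmetric matrix of edge
  multiplicities. Self-loops are representable; no convention about how often a loop counts
  for the degree is needed below, since degrees are only used for loop-free graphs.
\<close>

record 'v mgraph =
  verts :: "'v set"
  nedges :: "'v \<Rightarrow> 'v \<Rightarrow> nat"

definition wf_graph :: "'v mgraph \<Rightarrow> bool" where
  "wf_graph H \<longleftrightarrow>
     (\<forall>u v. nedges H u v = nedges H v u) \<and> (\<forall>u v. nedges H u v > 0 \<longrightarrow> u \<in> verts H)"

definition loop_free :: "'v mgraph \<Rightarrow> bool" where
  "loop_free H \<longleftrightarrow> (\<forall>v. nedges H v v = 0)"

definition simple_graph :: "'v mgraph \<Rightarrow> bool" where
  "simple_graph H \<longleftrightarrow> loop_free H \<and> (\<forall>u v. nedges H u v \<le> 1)"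

definition adj :: "'v mgraph \<Rightarrow> ('v \<times> 'v) set" where
  "adj H = {(u, v). nedges H u v > 0}"

definition neighbours :: "'v mgraph \<Rightarrow> 'v \<Rightarrow> 'v set" where
  "neighbours H v = {w. (v, w) \<in> adj H}"

definition deg :: "'v mgraph \<Rightarrow> 'v \<Rightarrow> nat" where
  "deg H v = (\<Sum>w\<in>neighbours H v. nedges H v w)"

definition locally_finite :: "'v mgraph \<Rightarrow> bool" where
  "locally_finite H \<longleftrightarrow> (\<forall>v. finite (neighbours H v))"

definition connected_graph :: "'v mgraph \<Rightarrow> bool" where
  "connected_graph H \<longleftrightarrow> (\<forall>u\<in>verts H. \<forall>v\<in>verts H. (u, v) \<in> (adj H)\<^sup>*)"

text \<open>The infimum over the empty set of path lengths is \<open>\<infinity>\<close>.\<close>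

definition gdist :: "'v mgraph \<Rightarrow> 'v \<Rightarrow> 'v \<Rightarrow> enat" where
  "gdist H u v = (INF m\<in>{m. (u, v) \<in> adj H ^^ m}. enat m)"

definition induced :: "'v mgraph \<Rightarrow> 'v set \<Rightarrow> 'v mgraph" where
  "induced H S = \<lparr>verts = verts H \<inter> S, nedges = (\<lambda>u v. if u \<in> S \<and> v \<in> S then nedges H u v else 0)\<rparr>"

type_synonym 'v rooted = "'v mgraph \<times> 'v"

definition rball :: "nat \<Rightarrow> 'v rooted \<Rightarrow> 'v rooted" where
  "rball r X = (induced (fst X) {v. gdist (fst X) (snd X) v \<le> enat r}, snd X)"

definition rooted_iso :: "('v \<Rightarrow> 'w) \<Rightarrow> 'v rooted \<Rightarrow> 'w rooted \<Rightarrow> bool" where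
  "rooted_iso f X Y \<longleftrightarrow>
     bij_betw f (verts (fst X)) (verts (fst Y)) \<and> f (snd X) = snd Y \<and>
     (\<forall>u\<in>verts (fst X). \<forall>v\<in>verts (fst X). nedges (fst Y) (f u) (f v) = nedges (fst X) u v)"

definition isomorphic :: "'v rooted \<Rightarrow> 'w rooted \<Rightarrow> bool" where
  "isomorphic X Y \<longleftrightarrow> (\<exists>f. rooted_iso f X Y)"

text \<open>
  Connected locally finite graphs are countable, so every rooted-isomorphism class has a
  representative with vertices in \<^typ>\<open>nat\<close>; the quotient type \<open>rgraph\<close> below is the space
  of connected locally finite rooted graphs up to rooted isomorphism.
\<close>

definition rooted_graph :: "'v rooted \<Rightarrow> bool" where
  "rooted_graph X \<longleftrightarrow> wf_graph (fst X) \<and> connected_graph (fst X) \<and>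
     locally_finite (fst X) \<and> snd X \<in> verts (fst X)"

text \<open>
  The radius-0 balls may differ (by loops at the root); then the supremum over the empty set
  is 0 and the distance is 1. Isomorphic graphs have supremum \<open>\<infinity>\<close> and distance 0.
\<close>

definition rooted_dist :: "'v rooted \<Rightarrow> 'v rooted \<Rightarrow> real" where
  "rooted_dist X Y =
     (case (SUP r\<in>{r. isomorphic (rball r X) (rball r Y)}. enat r) of
        enat m \<Rightarrow> 1 / (1 + real m) | \<infinity> \<Rightarrow> 0)"

subsection \<open>The metric space of rooted graphs\<close>

lemma isomorphic_refl [simp]: "isomorphic X X"
  unfolding isomorphic_def rooted_iso_def by (rule exI[of _ id]) auto

lemma rooted_iso_inv:
  assumes "rooted_iso f X Y" "snd X \<in> verts (fst X)"
  shows "rooted_iso (the_inv_into (verts (fst X)) f) Y X"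
proof -
  let ?g = "the_inv_into (verts (fst X)) f"
  have b: "bij_betw f (verts (fst X)) (verts (fst Y))" using assms by (simp add: rooted_iso_def)
  have g: "bij_betw ?g (verts (fst Y)) (verts (fst X))" using b by (rule bij_betw_the_inv_into)
  have fg: "f (?g y) = y" "?g y \<in> verts (fst X)" if "y \<in> verts (fst Y)" for y
    using f_the_inv_into_f_bij_betw[OF b] g that by (auto simp: bij_betw_def)
  have "?g (snd Y) = snd X"
    using assms b by (metis bij_betw_def rooted_iso_def the_inv_into_f_f)
  moreover have "nedges (fst X) (?g u) (?g v) = nedges (fst Y) u v"
    if "u \<in> verts (fst Y)" "v \<in> verts (fst Y)" for u v
    using assms(1) fg that unfolding rooted_iso_def by metis
  ultimately show ?thesis using g by (simp add: rooted_iso_def)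
qed

lemma isomorphic_sym:
  assumes "isomorphic X Y" "snd X \<in> verts (fst X)" shows "isomorphic Y X"
  using assms rooted_iso_inv unfolding isomorphic_def by blast

lemma rooted_iso_comp:
  assumes "rooted_iso f X Y" "rooted_iso g Y Z" shows "rooted_iso (g \<circ> f) X Z"
proof -
  have "f u \<in> verts (fst Y)" if "u \<in> verts (fst X)" for u
    using assms(1) that by (auto simp: rooted_iso_def bij_betw_def)
  then show ?thesis
    using assms by (auto simp: rooted_iso_def intro: bij_betw_trans)
qed

lemma isomorphic_trans: "isomorphic X Y \<Longrightarrow> isomorphic Y Z \<Longrightarrow> isomorphic X Z"
  unfolding isomorphic_def using rooted_iso_comp by blast

lemma gdist_le_iff: "gdist H u v \<le> enat r \<longleftrightarrow> (\<exists>m\<le>r. (u, v) \<in> adj H ^^ m)"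
proof
  assume *: "gdist H u v \<le> enat r"
  then have ne: "{m. (u, v) \<in> adj H ^^ m} \<noteq> {}"
    unfolding gdist_def by (intro notI) (simp add: top_enat_def)
  then obtain m where "m \<in> {m. (u, v) \<in> adj H ^^ m}" by (rule ex_in_conv[THEN iffD2, THEN exE])
  then have "gdist H u v \<in> enat ` {m. (u, v) \<in> adj H ^^ m}"
    unfolding gdist_def by (rule wellorder_InfI[OF imageI])
  then show "\<exists>m\<le>r. (u, v) \<in> adj H ^^ m" using * by auto
next
  assume "\<exists>m\<le>r. (u, v) \<in> adj H ^^ m"
  then obtain m where "m \<le> r" "(u, v) \<in> adj H ^^ m" by blast
  then show "gdist H u v \<le> enat r" unfolding gdist_def by (intro INF_lower2[of m]) auto
qed

lemma wf_adj: "wf_graph H \<Longrightarrow> (u, v) \<in> adj H \<Longrightarrow> u \<in> verts H \<and> v \<in> verts H"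
  by (simp add: adj_def) (metis wf_graph_def)

lemma relpow_adj_iso:
  assumes wf: "wf_graph (fst X)" and f: "rooted_iso f X Y" and u: "u \<in> verts (fst X)"
    and p: "(u, v) \<in> adj (fst X) ^^ m"
  shows "(f u, f v) \<in> adj (fst Y) ^^ m"
  using p
proof (induction m arbitrary: v)
  case (Suc m)
  then obtain w where w: "(u, w) \<in> adj (fst X) ^^ m" "(w, v) \<in> adj (fst X)" by auto
  then have "(f w, f v) \<in> adj (fst Y)"
    using f wf_adj[OF wf w(2)] by (auto simp: adj_def rooted_iso_def)
  then show ?case using Suc.IH[OF w(1)] by auto
qed auto

lemma gdist_eqI:
  assumes "\<And>m. (u, v) \<in> adj H ^^ m \<longleftrightarrow> (u', v') \<in> adj H' ^^ m"
  shows "gdist H u v = gdist H' u' v'"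
  unfolding gdist_def using assms by simp

lemma gdist_iso:
  assumes wf: "wf_graph (fst X)" "wf_graph (fst Y)" and f: "rooted_iso f X Y"
    and r: "snd X \<in> verts (fst X)"
    and u: "u \<in> verts (fst X)" and v: "v \<in> verts (fst X)"
  shows "gdist (fst Y) (f u) (f v) = gdist (fst X) u v"
proof (rule gdist_eqI)
  fix m
  let ?g = "the_inv_into (verts (fst X)) f"
  have b: "bij_betw f (verts (fst X)) (verts (fst Y))" using f by (simp add: rooted_iso_def)
  have gf: "?g (f x) = x" "f x \<in> verts (fst Y)" if "x \<in> verts (fst X)" for x
    using b that by (auto simp: bij_betw_def the_inv_into_f_f)
  show "(f u, f v) \<in> adj (fst Y) ^^ m \<longleftrightarrow> (u, v) \<in> adj (fst X) ^^ m"
    using relpow_adj_iso[OF wf(1) f u] relpow_adj_iso[OF wf(2) rooted_iso_inv[OF f r], of "f u" "f v" m]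
      gf u v by auto
qed

lemma wf_induced: "wf_graph H \<Longrightarrow> wf_graph (induced H S)"
  unfolding wf_graph_def induced_def by auto

lemma wf_rball: "wf_graph (fst X) \<Longrightarrow> wf_graph (fst (rball r X))"
  by (simp add: rball_def wf_induced)

lemma snd_rball [simp]: "snd (rball r X) = snd X"
  by (simp add: rball_def)

lemma gdist_self [simp]: "gdist H u u = 0"
proof -
  have "gdist H u u \<le> enat 0" by (subst gdist_le_iff) auto
  then show ?thesis by (simp add: zero_enat_def[symmetric])
qed

lemma root_in_rball: "snd X \<in> verts (fst X) \<Longrightarrow> snd X \<in> verts (fst (rball r X))"
  by (simp add: rball_def induced_def)

lemma relpow_rball:
  assumes "(snd X, v) \<in> adj (fst X) ^^ m" "m \<le> r"
  shows "(snd X, v) \<in> adj (fst (rball r X)) ^^ m"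
  using assms
proof (induction m arbitrary: v)
  case (Suc m)
  then obtain w where w: "(snd X, w) \<in> adj (fst X) ^^ m" "(w, v) \<in> adj (fst X)" by auto
  have "gdist (fst X) (snd X) w \<le> enat r" "gdist (fst X) (snd X) v \<le> enat r"
    using w Suc.prems by (auto simp only: gdist_le_iff intro: Suc_leD)
  then have "(w, v) \<in> adj (fst (rball r X))"
    using w(2) by (simp add: adj_def rball_def induced_def)
  then show ?case using Suc w by auto
qed auto

lemma relpow_rball_D:
  assumes "(u, v) \<in> adj (fst (rball r X)) ^^ m" shows "(u, v) \<in> adj (fst X) ^^ m"
  using assms
proof (induction m arbitrary: v)
  case (Suc m)
  then obtain w where w: "(u, w) \<in> adj (fst (rball r X)) ^^ m" "(w, v) \<in> adj (fst (rball r X))"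
    by auto
  then have "(w, v) \<in> adj (fst X)" by (auto simp: adj_def rball_def induced_def split: if_splits)
  then show ?case using Suc w by auto
qed auto

lemma rball_rball: "s \<le> r \<Longrightarrow> rball s (rball r X) = rball s X"
proof -
  assume sr: "s \<le> r"
  have *: "gdist (fst (rball r X)) (snd X) v \<le> enat s \<longleftrightarrow> gdist (fst X) (snd X) v \<le> enat s" for v
    unfolding gdist_le_iff using relpow_rball relpow_rball_D sr by (metis le_trans)
  have **: "gdist (fst X) (snd X) v \<le> enat s \<Longrightarrow> gdist (fst X) (snd X) v \<le> enat r" for v
    using sr by (meson enat_ord_simps(1) order_trans)
  show ?thesis
    unfolding rball_def[of s] using * ** by (auto simp: rball_def induced_def fun_eq_iff)
qed

lemma rooted_iso_rball:
  assumes wf: "wf_graph (fst X)" "wf_graph (fst Y)" and f: "rooted_iso f X Y"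
    and r: "snd X \<in> verts (fst X)"
  shows "rooted_iso f (rball s X) (rball s Y)"
proof -
  have b: "bij_betw f (verts (fst X)) (verts (fst Y))" and fr: "f (snd X) = snd Y"
    using f by (auto simp: rooted_iso_def)
  have d: "gdist (fst Y) (snd Y) (f v) = gdist (fst X) (snd X) v" if "v \<in> verts (fst X)" for v
    using gdist_iso[OF wf f r r that] fr by simp
  have "bij_betw f (verts (fst (rball s X))) (verts (fst (rball s Y)))"
    unfolding bij_betw_def
  proof
    show "inj_on f (verts (fst (rball s X)))"
      using b by (auto simp: rball_def induced_def bij_betw_def inj_on_def)
    show "f ` verts (fst (rball s X)) = verts (fst (rball s Y))"
    proof (intro set_eqI iffI)
      fix y assume "y \<in> verts (fst (rball s Y))"
      then have y: "y \<in> verts (fst Y)" "gdist (fst Y) (snd Y) y \<le> enat s"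
        by (auto simp: rball_def induced_def)
      then obtain x where "x \<in> verts (fst X)" "y = f x" using b by (auto simp: bij_betw_def)
      then show "y \<in> f ` verts (fst (rball s X))" using y d
        by (auto simp: rball_def induced_def)
    qed (use b d in \<open>auto simp: rball_def induced_def bij_betw_def\<close>)
  qed
  then show ?thesis using f d by (auto simp: rooted_iso_def rball_def induced_def)
qed

lemma isomorphic_rball_mono:
  assumes "wf_graph (fst X)" "wf_graph (fst Y)" "snd X \<in> verts (fst X)"
    and "isomorphic (rball r X) (rball r Y)" "s \<le> r"
  shows "isomorphic (rball s X) (rball s Y)"
proof -
  obtain f where f: "rooted_iso f (rball r X) (rball r Y)" using assms by (auto simp: isomorphic_def)
  have "rooted_iso f (rball s (rball r X)) (rball s (rball r Y))"
    by (intro rooted_iso_rball wf_rball root_in_rball assms f) (simp add: root_in_rball assms)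
  then have "rooted_iso f (rball s X) (rball s Y)" by (simp add: rball_rball[OF assms(5)])
  then show ?thesis by (auto simp only: isomorphic_def)
qed

lemma isomorphic_imp_rball:
  assumes "wf_graph (fst X)" "wf_graph (fst Y)" "snd X \<in> verts (fst X)" "isomorphic X Y"
  shows "isomorphic (rball s X) (rball s Y)"
  using assms rooted_iso_rball unfolding isomorphic_def by blast

lemma rooted_dist_ge_iff:
  assumes "wf_graph (fst X)" "wf_graph (fst Y)" "snd X \<in> verts (fst X)"
  shows "rooted_dist X Y < 1 / (1 + real r) \<longleftrightarrow> isomorphic (rball (Suc r) X) (rball (Suc r) Y)"
proof -
  define S where "S = {r. isomorphic (rball r X) (rball r Y)}"
  have down: "s \<in> S" if "r \<in> S" "s \<le> r" for r s
    using isomorphic_rball_mono[OF assms] that by (auto simp: S_def)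
  define m where "m = (SUP r\<in>S. enat r)"
  have *: "enat (Suc r) \<le> m \<longleftrightarrow> Suc r \<in> S"
  proof
    assume "enat (Suc r) \<le> m"
    then have "enat r < m" by (metis Suc_ile_eq)
    then obtain s where "s \<in> S" "enat r < enat s" unfolding m_def less_SUP_iff by blast
    then show "Suc r \<in> S" using down[of s "Suc r"] by auto
  qed (auto simp: m_def intro: SUP_upper)
  have "rooted_dist X Y < 1 / (1 + real r) \<longleftrightarrow> enat (Suc r) \<le> m"
    unfolding rooted_dist_def S_def[symmetric] m_def[symmetric]
    by (cases m) (auto simp: field_simps)
  then show ?thesis using * by (simp add: S_def)
qed

lemma rooted_dist_nonneg: "0 \<le> rooted_dist X Y"
  unfolding rooted_dist_def by (auto split: enat.splits)

lemma finite_rball: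
  assumes "rooted_graph X" shows "finite (verts (fst (rball r X)))"
proof -
  have "finite {v. (snd X, v) \<in> adj (fst X) ^^ m}" for m
  proof (induction m)
    case (Suc m)
    have "{v. (snd X, v) \<in> adj (fst X) ^^ Suc m} =
        (\<Union>w\<in>{v. (snd X, v) \<in> adj (fst X) ^^ m}. neighbours (fst X) w)"
      by (auto simp: neighbours_def)
    then show ?case using Suc assms by (auto simp: rooted_graph_def locally_finite_def)
  qed auto
  then have "finite (\<Union>m\<le>r. {v. (snd X, v) \<in> adj (fst X) ^^ m})" by blast
  moreover have "verts (fst (rball r X)) \<subseteq> (\<Union>m\<le>r. {v. (snd X, v) \<in> adj (fst X) ^^ m})"
    by (auto simp: rball_def induced_def gdist_le_iff)
  ultimately show ?thesis by (rule rev_finite_subset)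
qed

lemma rooted_graph_reach:
  assumes "rooted_graph X" "v \<in> verts (fst X)"
  obtains r where "v \<in> verts (fst (rball r X))"
proof -
  have "(snd X, v) \<in> (adj (fst X))\<^sup>*"
    using assms by (auto simp: rooted_graph_def connected_graph_def)
  then obtain m where "(snd X, v) \<in> adj (fst X) ^^ m" using rtrancl_imp_relpow by blast
  then show ?thesis using assms(2) by (intro that[of m]) (auto simp: rball_def induced_def gdist_le_iff)
qed

lemma rball_mono: "s \<le> r \<Longrightarrow> verts (fst (rball s X)) \<subseteq> verts (fst (rball r X))"
  by (auto simp: rball_def induced_def intro: order_trans)

lemma isomorphic_if_rballs:
  fixes X Y :: "nat rooted"
  assumes X: "rooted_graph X" and Y: "rooted_graph Y"
    and iso: "\<And>r. isomorphic (rball r X) (rball r Y)"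
  shows "isomorphic X Y"
proof -
  let ?V = "\<lambda>r. verts (fst (rball r X))" and ?W = "\<lambda>r. verts (fst (rball r Y))"
  have wf: "wf_graph (fst X)" "wf_graph (fst Y)" "snd X \<in> verts (fst X)"
    using X Y by (auto simp: rooted_graph_def)
  have "\<exists>f. \<forall>r. rooted_iso (f r) (rball r X) (rball r Y) \<and> (\<forall>v. v \<notin> ?V r \<longrightarrow> f r v = 0)"
  proof -
    have "\<exists>f. rooted_iso f (rball r X) (rball r Y) \<and> (\<forall>v. v \<notin> ?V r \<longrightarrow> f v = 0)" for r
    proof -
      obtain f where f: "rooted_iso f (rball r X) (rball r Y)" using iso isomorphic_def by blast
      let ?f = "\<lambda>v. if v \<in> ?V r then f v else 0"
      have "bij_betw ?f (?V r) (?W r) = bij_betw f (?V r) (?W r)" by (rule bij_betw_cong) auto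
      then have "rooted_iso ?f (rball r X) (rball r Y)"
        using f root_in_rball[OF wf(3)] by (auto simp: rooted_iso_def)
      then show ?thesis by (intro exI[of _ ?f]) auto
    qed
    then show ?thesis by (intro choice) auto
  qed
  then obtain f where f: "\<And>r. rooted_iso (f r) (rball r X) (rball r Y)"
    and f0: "\<And>r v. v \<notin> ?V r \<Longrightarrow> f r v = 0" by blast
  have fs: "rooted_iso (f r) (rball s X) (rball s Y)" if "s \<le> r" for r s
    using rooted_iso_rball[OF wf_rball[OF wf(1)] wf_rball[OF wf(2)] f, of r s] that
      root_in_rball[OF wf(3)] by (simp add: rball_rball)
  define K where "K v = (if \<exists>r. v \<in> ?V r then insert 0 (?W (LEAST r. v \<in> ?V r)) else {0})" for v
  have finK: "finite (K v)" for v using finite_rball[OF Y] by (auto simp: K_def)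
  have fK: "f r v \<in> K v" for r v
  proof (cases "v \<in> ?V r")
    case True
    define s where "s = (LEAST r. v \<in> ?V r)"
    have "v \<in> ?V s" "s \<le> r" using True by (auto simp: s_def intro: LeastI Least_le)
    then have "f r v \<in> ?W s" using fs[of s r] by (auto simp: rooted_iso_def bij_betw_def)
    then show ?thesis using True by (auto simp: K_def s_def)
  qed (auto simp: f0 K_def)
  have "compact (PiE UNIV K)"
    using finK
    by (simp add: compactin_PiE finite_imp_compactin flip: compactin_euclidean_iff euclidean_product_topology)
  then have "seq_compact (PiE UNIV K)" by (rule compact_imp_seq_compact)
  moreover have "\<forall>r. f r \<in> PiE UNIV K" using fK by auto
  ultimately obtain g \<sigma> where \<sigma>: "strict_mono \<sigma>" and lim: "(f \<circ> \<sigma>) \<longlonglongrightarrow> g"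
    unfolding seq_compact_def by metis
  have ev: "\<forall>\<^sub>F n in sequentially. f (\<sigma> n) v = g v" for v
  proof -
    have "open ((\<lambda>h. h v) -` {g v})"
      by (intro open_vimage continuous_on_product_coordinates) (rule Topological_Spaces.open_discrete)
    then have "\<forall>\<^sub>F n in sequentially. (f \<circ> \<sigma>) n \<in> (\<lambda>h. h v) -` {g v}"
      by (rule topological_tendstoD[OF lim]) simp
    then show ?thesis by simp
  qed
  have g: "rooted_iso g (rball s X) (rball s Y)" for s
  proof -
    have "\<forall>\<^sub>F n in sequentially. \<forall>v\<in>?V s. f (\<sigma> n) v = g v"
      using finite_rball[OF X] ev by (intro eventually_ball_finite) auto
    moreover have "\<forall>\<^sub>F n in sequentially. n \<ge> s" by (rule eventually_ge_at_top)
    ultimately have "\<forall>\<^sub>F n in sequentially. n \<ge> s \<and> (\<forall>v\<in>?V s. f (\<sigma> n) v = g v)"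
      by eventually_elim auto
    then obtain n where n: "n \<ge> s" "\<forall>v\<in>?V s. f (\<sigma> n) v = g v"
      using eventually_happens by fastforce
    then have "s \<le> \<sigma> n" using seq_suble[OF \<sigma>, of n] by simp
    then have fi: "rooted_iso (f (\<sigma> n)) (rball s X) (rball s Y)" by (rule fs)
    have "bij_betw g (?V s) (?W s) = bij_betw (f (\<sigma> n)) (?V s) (?W s)"
      using n by (intro bij_betw_cong) auto
    then show ?thesis
      using fi n(2) root_in_rball[OF wf(3)] by (auto simp: rooted_iso_def)
  qed
  have inV: "\<exists>s. u \<in> ?V s \<and> v \<in> ?V s" if "u \<in> verts (fst X)" "v \<in> verts (fst X)" for u v
  proof -
    obtain a where "u \<in> ?V a" using rooted_graph_reach[OF X \<open>u \<in> verts (fst X)\<close>] .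
    moreover obtain b where "v \<in> ?V b" using rooted_graph_reach[OF X \<open>v \<in> verts (fst X)\<close>] .
    ultimately show ?thesis using rball_mono[of a "max a b" X] rball_mono[of b "max a b" X]
      by (intro exI[of _ "max a b"]) auto
  qed
  have sub: "?V s \<subseteq> verts (fst X)" "?W s \<subseteq> verts (fst Y)" for s
    by (auto simp: rball_def induced_def)
  have "rooted_iso g X Y"
    unfolding rooted_iso_def
  proof (intro conjI ballI)
    show "g (snd X) = snd Y" using g[of 0] by (simp add: rooted_iso_def)
    show "bij_betw g (verts (fst X)) (verts (fst Y))"
      unfolding bij_betw_def
    proof (intro conjI inj_onI subset_antisym subsetI)
      fix u v assume uv: "u \<in> verts (fst X)" "v \<in> verts (fst X)" "g u = g v"
      then obtain s where "u \<in> ?V s" "v \<in> ?V s" using inV by blast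
      then show "u = v" using g[of s] uv(3) by (auto simp: rooted_iso_def bij_betw_def inj_on_def)
    next
      fix y assume "y \<in> g ` verts (fst X)"
      then obtain u where "u \<in> verts (fst X)" "y = g u" by blast
      moreover then obtain s where "u \<in> ?V s" using inV by blast
      ultimately show "y \<in> verts (fst Y)"
        using g[of s] sub(2)[of s] by (auto simp: rooted_iso_def bij_betw_def)
    next
      fix y assume "y \<in> verts (fst Y)"
      then obtain s where "y \<in> ?W s" using rooted_graph_reach[OF Y] by metis
      then have "y \<in> g ` ?V s" using g[of s] by (simp add: rooted_iso_def bij_betw_def)
      then show "y \<in> g ` verts (fst X)" using sub(1)[of s] by blast
    qed
    fix u v assume uv: "u \<in> verts (fst X)" "v \<in> verts (fst X)"
    then obtain s where s: "u \<in> ?V s" "v \<in> ?V s" using inV by blast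
    then have "g u \<in> ?W s" "g v \<in> ?W s" using g[of s] by (auto simp: rooted_iso_def bij_betw_def)
    then have "nedges (fst (rball s Y)) (g u) (g v) = nedges (fst Y) (g u) (g v)"
      "nedges (fst (rball s X)) u v = nedges (fst X) u v"
      using s by (auto simp: rball_def induced_def)
    then show "nedges (fst Y) (g u) (g v) = nedges (fst X) u v"
      using g[of s] s by (auto simp: rooted_iso_def)
  qed
  then show ?thesis by (auto simp: isomorphic_def)
qed

quotient_type rgraph = "nat rooted" / partial: "\<lambda>X Y. rooted_graph X \<and> rooted_graph Y \<and> isomorphic X Y"
proof (rule part_equivpI)
  let ?H = "\<lparr>verts = {0::nat}, nedges = (\<lambda>_ _. 0)\<rparr>"
  have "rooted_graph (?H, 0)"
    by (auto simp: rooted_graph_def wf_graph_def connected_graph_def locally_finite_def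
        neighbours_def adj_def)
  then show "\<exists>X::nat rooted. rooted_graph X \<and> rooted_graph X \<and> isomorphic X X" by auto
qed (auto simp: symp_def transp_def rooted_graph_def intro: isomorphic_sym isomorphic_trans)

instantiation rgraph :: metric_space
begin

lift_definition dist_rgraph :: "rgraph \<Rightarrow> rgraph \<Rightarrow> real" is rooted_dist
proof -
  fix X X' Y Y' :: "nat rooted"
  assume a: "rooted_graph X \<and> rooted_graph X' \<and> isomorphic X X'"
    and b: "rooted_graph Y \<and> rooted_graph Y' \<and> isomorphic Y Y'"
  have 1: "isomorphic (rball r X) (rball r X')" "isomorphic (rball r X') (rball r X)"
     "isomorphic (rball r Y) (rball r Y')" "isomorphic (rball r Y') (rball r Y)" for r
    using a b by (auto simp: rooted_graph_def intro!: isomorphic_imp_rball intro: isomorphic_sym)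
  have "isomorphic (rball r X) (rball r Y) \<longleftrightarrow> isomorphic (rball r X') (rball r Y')" for r
    using isomorphic_trans[OF isomorphic_trans[OF 1(2) _] 1(3)]
      isomorphic_trans[OF isomorphic_trans[OF 1(1) _] 1(4)] by (rule iffI)
  then show "rooted_dist X Y = rooted_dist X' Y'" by (simp add: rooted_dist_def)
qed

definition uniformity_rgraph :: "(rgraph \<times> rgraph) filter" where
  "uniformity_rgraph = (INF e\<in>{0 <..}. principal {(x, y). dist x y < e})"

definition open_rgraph :: "rgraph set \<Rightarrow> bool" where
  "open_rgraph U \<longleftrightarrow> (\<forall>x\<in>U. \<forall>\<^sub>F (x', y) in uniformity. x' = x \<longrightarrow> y \<in> U)"

instance
proof
  fix x y z :: rgraph
  show "dist x y = 0 \<longleftrightarrow> x = y"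
  proof
    assume "dist x y = 0"
    then show "x = y"
    proof (transfer)
      fix X Y :: "nat rooted"
      assume a: "rooted_graph X \<and> rooted_graph X \<and> isomorphic X X"
        "rooted_graph Y \<and> rooted_graph Y \<and> isomorphic Y Y"  "rooted_dist X Y = 0"
      have "isomorphic (rball (Suc r) X) (rball (Suc r) Y)" for r
        using rooted_dist_ge_iff[of X Y r] a by (auto simp: rooted_graph_def)
      then have "isomorphic (rball r X) (rball r Y)" for r
        using isomorphic_rball_mono[of X Y "Suc r" r] a by (auto simp: rooted_graph_def)
      then show "rooted_graph X \<and> rooted_graph Y \<and> isomorphic X Y"
        using a isomorphic_if_rballs by blast
    qed
  next
    assume "x = y"
    then show "dist x y = 0"
    proof (transfer)
      fix X Y :: "nat rooted"
      assume a: "rooted_graph X \<and> rooted_graph Y \<and> isomorphic X Y"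
      have "isomorphic (rball r X) (rball r Y)" for r
        using a by (intro isomorphic_imp_rball) (auto simp: rooted_graph_def)
      then have lt: "rooted_dist X Y < 1 / (1 + real r)" for r
        using rooted_dist_ge_iff[of X Y r] a by (auto simp: rooted_graph_def)
      show "rooted_dist X Y = 0"
      proof (rule ccontr)
        assume "rooted_dist X Y \<noteq> 0"
        then have "rooted_dist X Y > 0" using rooted_dist_nonneg[of X Y] by simp
        then obtain r where "inverse (real (Suc r)) < rooted_dist X Y" using reals_Archimedean by blast
        then show False using lt[of r] by (simp add: inverse_eq_divide)
      qed
    qed
  qed
  have "dist x y \<le> max (dist x z) (dist y z)"
  proof (transfer)
    fix X Y Z :: "nat rooted"
    assume "rooted_graph X \<and> rooted_graph X \<and> isomorphic X X"
        "rooted_graph Y \<and> rooted_graph Y \<and> isomorphic Y Y"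
        "rooted_graph Z \<and> rooted_graph Z \<and> isomorphic Z Z"
    then have wf: "wf_graph (fst X)" "wf_graph (fst Y)" "wf_graph (fst Z)"
       "snd X \<in> verts (fst X)" "snd Y \<in> verts (fst Y)" "snd Z \<in> verts (fst Z)"
      by (auto simp: rooted_graph_def)
    let ?a = "{r. isomorphic (rball r X) (rball r Z)}"
    let ?b = "{r. isomorphic (rball r Y) (rball r Z)}"
    let ?c = "{r. isomorphic (rball r X) (rball r Y)}"
    have sub: "?a \<inter> ?b \<subseteq> ?c"
    proof
      fix r assume "r \<in> ?a \<inter> ?b"
      then have "isomorphic (rball r X) (rball r Z)" "isomorphic (rball r Z) (rball r Y)"
        using wf by (auto intro!: isomorphic_sym root_in_rball)
      then show "r \<in> ?c" using isomorphic_trans by blast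
    qed
    have "?a \<subseteq> ?b \<or> ?b \<subseteq> ?a"
    proof (rule ccontr)
      assume "\<not> ?thesis"
      then obtain r s where "r \<in> ?a" "r \<notin> ?b" "s \<in> ?b" "s \<notin> ?a" by blast
      then show False
        using isomorphic_rball_mono[of X Z r s] isomorphic_rball_mono[of Y Z s r] wf
        by (cases "r \<le> s") auto
    qed
    then have "?a \<subseteq> ?c \<or> ?b \<subseteq> ?c" using sub by blast
    moreover have anti: "(case (SUP r\<in>B. enat r) of enat m \<Rightarrow> 1 / (1 + real m) | \<infinity> \<Rightarrow> 0)
        \<le> (case (SUP r\<in>A. enat r) of enat m \<Rightarrow> 1 / (1 + real m) | \<infinity> \<Rightarrow> 0)"
      if "A \<subseteq> B" for A B :: "nat set"
    proof -
      have "(SUP r\<in>A. enat r) \<le> (SUP r\<in>B. enat r)" using that by (intro SUP_subset_mono) auto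
      then show ?thesis
        by (cases "SUP r\<in>A. enat r"; cases "SUP r\<in>B. enat r") (auto simp: frac_le)
    qed
    ultimately show "rooted_dist X Y \<le> max (rooted_dist X Z) (rooted_dist Y Z)"
      unfolding rooted_dist_def le_max_iff_disj using anti by blast
  qed
  moreover have "0 \<le> dist x z" "0 \<le> dist y z"
    by (transfer, rule rooted_dist_nonneg)+
  ultimately show "dist x y \<le> dist x z + dist y z" by linarith
qed (rule uniformity_rgraph_def open_rgraph_def)+

end

subsection \<open>Exploration of the limit tree\<close>

datatype exploration = NonBacktracking | Backtracking

definition is_cycle :: "'v mgraph \<Rightarrow> 'v list \<Rightarrow> bool" where
  "is_cycle H c \<longleftrightarrow> length c \<ge> 3 \<and> distinct c \<and>
     (\<forall>i<length c. (c ! i, c ! (Suc i mod length c)) \<in> adj H)"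

text \<open>
  Double edges and loops are excluded by \<^const>\<open>simple_graph\<close>, hence cycles have length at
  least 3.
\<close>

definition is_tree :: "'v mgraph \<Rightarrow> bool" where
  "is_tree H \<longleftrightarrow> connected_graph H \<and> simple_graph H \<and> (\<nexists>c. is_cycle H c)"

definition offspring :: "'v rooted \<Rightarrow> 'v \<Rightarrow> 'v set" where
  "offspring X v =
     {w \<in> neighbours (fst X) v. gdist (fst X) (snd X) w = gdist (fst X) (snd X) v + 1}"

fun admissible_tree :: "exploration \<Rightarrow> 'v rooted \<Rightarrow> bool" where
  "admissible_tree NonBacktracking X \<longleftrightarrow>
     is_tree (fst X) \<and> infinite (verts (fst X)) \<and> (\<forall>v\<in>verts (fst X). offspring X v \<noteq> {})"
| "admissible_tree Backtracking X \<longleftrightarrow> is_tree (fst X) \<and> verts (fst X) \<noteq> {snd X}"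

fun walk_moves :: "exploration \<Rightarrow> 'v rooted \<Rightarrow> 'v \<Rightarrow> 'v set" where
  "walk_moves NonBacktracking X v = offspring X v"
| "walk_moves Backtracking X v = neighbours (fst X) v"

text \<open>
  \<open>pmf (tree_walk ex X k) j\<close> is the probability that the walk started at the root is at \<open>j\<close>
  after \<open>k\<close> steps. Staying put at a vertex without admissible moves only makes the walk total;
  it cannot happen on the trees of \<open>admissible_tree\<close>.
\<close>

primrec tree_walk :: "exploration \<Rightarrow> 'v rooted \<Rightarrow> nat \<Rightarrow> 'v pmf" where
  "tree_walk ex X 0 = return_pmf (snd X)"
| "tree_walk ex X (Suc k) = bind_pmf (tree_walk ex X k)
     (\<lambda>v. if walk_moves ex X v = {} then return_pmf v else pmf_of_set (walk_moves ex X v))"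

definition root_bias_rep :: "exploration \<Rightarrow> nat \<Rightarrow> 'v rooted \<Rightarrow> real" where
  "root_bias_rep ex k X =
     (\<Sum>\<^sub>\<infinity>j\<in>verts (fst X). pmf (tree_walk ex X k) j * real (deg (fst X) j)) - real (deg (fst X) (snd X))"

lemma neighbours_iso:
  assumes wf: "wf_graph (fst X)" "wf_graph (fst Y)" and f: "rooted_iso f X Y"
    and u: "u \<in> verts (fst X)"
  shows "neighbours (fst Y) (f u) = f ` neighbours (fst X) u"
proof (intro set_eqI iffI)
  fix y assume y: "y \<in> neighbours (fst Y) (f u)"
  then have "y \<in> verts (fst Y)" using wf_adj[OF wf(2)] by (auto simp: neighbours_def)
  then have "y \<in> f ` verts (fst X)" using f by (simp add: rooted_iso_def bij_betw_def)
  then obtain x where "x \<in> verts (fst X)" "y = f x" by blast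
  then show "y \<in> f ` neighbours (fst X) u"
    using y f u by (auto simp: neighbours_def adj_def rooted_iso_def)
next
  fix y assume "y \<in> f ` neighbours (fst X) u"
  then obtain x where x: "y = f x" "(u, x) \<in> adj (fst X)" by (auto simp: neighbours_def)
  then have "x \<in> verts (fst X)" using wf_adj[OF wf(1)] by blast
  then show "y \<in> neighbours (fst Y) (f u)"
    using x f u by (auto simp: neighbours_def adj_def rooted_iso_def)
qed

lemma neighbours_verts: "wf_graph H \<Longrightarrow> neighbours H v \<subseteq> verts H"
  using wf_adj by (force simp: neighbours_def)

lemma deg_iso:
  assumes wf: "wf_graph (fst X)" "wf_graph (fst Y)" and f: "rooted_iso f X Y"
    and u: "u \<in> verts (fst X)"
  shows "deg (fst Y) (f u) = deg (fst X) u"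
proof -
  have inj: "inj_on f (neighbours (fst X) u)"
    using f neighbours_verts[OF wf(1), of u] by (auto simp: rooted_iso_def bij_betw_def intro: inj_on_subset)
  show ?thesis
    unfolding deg_def neighbours_iso[OF assms]
    by (subst sum.reindex[OF inj], rule sum.cong)
      (use f u neighbours_verts[OF wf(1), of u] in \<open>auto simp: rooted_iso_def\<close>)
qed

lemma offspring_iso:
  assumes wf: "wf_graph (fst X)" "wf_graph (fst Y)" and f: "rooted_iso f X Y"
    and r: "snd X \<in> verts (fst X)" and u: "u \<in> verts (fst X)"
  shows "offspring Y (f u) = f ` offspring X u"
proof -
  have "gdist (fst Y) (snd Y) (f v) = gdist (fst X) (snd X) v" if "v \<in> verts (fst X)" for v
    using gdist_iso[OF wf f r r that] f by (simp add: rooted_iso_def)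
  then show ?thesis
    unfolding offspring_def neighbours_iso[OF wf f u]
    using u neighbours_verts[OF wf(1), of u] by auto
qed

lemma walk_moves_verts: "wf_graph (fst X) \<Longrightarrow> walk_moves ex X v \<subseteq> verts (fst X)"
  using neighbours_verts[of "fst X" v] by (cases ex) (auto simp: offspring_def)

lemma walk_moves_finite: "rooted_graph X \<Longrightarrow> finite (walk_moves ex X v)"
  by (cases ex) (auto simp: offspring_def rooted_graph_def locally_finite_def)

lemma tree_walk_verts:
  assumes "rooted_graph X" shows "set_pmf (tree_walk ex X k) \<subseteq> verts (fst X)"
proof (induction k)
  case (Suc k)
  have "walk_moves ex X v \<subseteq> verts (fst X)" for v
    by (rule walk_moves_verts) (use assms in \<open>simp add: rooted_graph_def\<close>)
  then have *: "set_pmf (if walk_moves ex X v = {} then return_pmf v else pmf_of_set (walk_moves ex X v))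
      \<subseteq> verts (fst X)" if "v \<in> verts (fst X)" for v
    using that walk_moves_finite[OF assms, of ex v] by (simp add: set_pmf_of_set)
  have "set_pmf (tree_walk ex X (Suc k)) = (\<Union>v\<in>set_pmf (tree_walk ex X k).
      set_pmf (if walk_moves ex X v = {} then return_pmf v else pmf_of_set (walk_moves ex X v)))"
    by (simp only: tree_walk.simps set_bind_pmf)
  also have "\<dots> \<subseteq> verts (fst X)"
    by (rule UN_least) (rule *[OF subsetD[OF Suc.IH]])
  finally show ?case .
qed (use assms in \<open>auto simp: rooted_graph_def\<close>)

lemma tree_walk_iso:
  assumes X: "rooted_graph X" and Y: "rooted_graph Y" and f: "rooted_iso f X Y"
  shows "tree_walk ex Y k = map_pmf f (tree_walk ex X k)"
proof (induction k)
  case 0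
  then show ?case using f by (simp add: rooted_iso_def)
next
  case (Suc k)
  have wf: "wf_graph (fst X)" "wf_graph (fst Y)" "snd X \<in> verts (fst X)"
    using X Y by (auto simp: rooted_graph_def)
  have m: "walk_moves ex Y (f u) = f ` walk_moves ex X u" if "u \<in> verts (fst X)" for u
    using neighbours_iso[OF wf(1,2) f that] offspring_iso[OF wf(1,2) f wf(3) that] by (cases ex) auto
  have inj: "inj_on f (walk_moves ex X u)" for u
    using f walk_moves_verts[OF wf(1), of ex u] by (auto simp: rooted_iso_def bij_betw_def intro: inj_on_subset)
  have "bind_pmf (tree_walk ex X k) (\<lambda>u. if walk_moves ex Y (f u) = {} then return_pmf (f u)
         else pmf_of_set (walk_moves ex Y (f u)))
      = bind_pmf (tree_walk ex X k) (\<lambda>u. map_pmf f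
         (if walk_moves ex X u = {} then return_pmf u else pmf_of_set (walk_moves ex X u)))"
    using tree_walk_verts[OF X, of ex k] m inj walk_moves_finite[OF X, of ex]
    by (intro bind_pmf_cong refl) (auto simp: map_pmf_of_set_inj)
  then show ?case by (simp add: Suc.IH bind_map_pmf map_bind_pmf)
qed

lemma root_bias_rep_iso:
  assumes X: "rooted_graph X" and Y: "rooted_graph Y" and iso: "isomorphic X Y"
  shows "root_bias_rep ex k X = root_bias_rep ex k Y"
proof -
  obtain f where f: "rooted_iso f X Y" using iso by (auto simp: isomorphic_def)
  have wf: "wf_graph (fst X)" "wf_graph (fst Y)" "snd X \<in> verts (fst X)"
    using X Y by (auto simp: rooted_graph_def)
  have b: "bij_betw f (verts (fst X)) (verts (fst Y))" and fr: "f (snd X) = snd Y"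
    using f by (auto simp: rooted_iso_def)
  have p: "pmf (map_pmf f (tree_walk ex X k)) (f j) = pmf (tree_walk ex X k) j"
    if "j \<in> verts (fst X)" for j
  proof -
    have "pmf (map_pmf f (tree_walk ex X k)) (f j)
       = measure_pmf.prob (tree_walk ex X k) (f -` {f j})" by (simp add: pmf_map)
    also have "\<dots> = measure_pmf.prob (tree_walk ex X k) {j}"
      using b that tree_walk_verts[OF X, of ex k]
      by (intro measure_pmf.finite_measure_eq_AE) (auto simp: AE_measure_pmf_iff bij_betw_def inj_on_def)
    finally show ?thesis by (simp add: measure_pmf_single)
  qed
  have "(\<Sum>\<^sub>\<infinity>j\<in>verts (fst Y). pmf (tree_walk ex Y k) j * real (deg (fst Y) j))
     = (\<Sum>\<^sub>\<infinity>j\<in>verts (fst X). pmf (tree_walk ex Y k) (f j) * real (deg (fst Y) (f j)))"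
    using infsum_reindex_bij_betw[OF b, of "\<lambda>j. pmf (tree_walk ex Y k) j * real (deg (fst Y) j)"]
    by simp
  also have "\<dots> = (\<Sum>\<^sub>\<infinity>j\<in>verts (fst X). pmf (tree_walk ex X k) j * real (deg (fst X) j))"
    by (intro infsum_cong) (simp add: tree_walk_iso[OF X Y f] p deg_iso[OF wf(1,2) f])
  finally show ?thesis
    using deg_iso[OF wf(1,2) f wf(3)] fr by (simp add: root_bias_rep_def)
qed

lemma is_tree_iso:
  assumes X: "rooted_graph X" and Y: "rooted_graph Y" and iso: "isomorphic X Y"
    and t: "is_tree (fst Y)"
  shows "is_tree (fst X)"
proof -
  obtain f where f: "rooted_iso f X Y" using iso by (auto simp: isomorphic_def)
  have wf: "wf_graph (fst X)" "wf_graph (fst Y)" "snd X \<in> verts (fst X)"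
    using X Y by (auto simp: rooted_graph_def)
  have m: "nedges (fst X) u v = nedges (fst Y) (f u) (f v)" if "u \<in> verts (fst X)" "v \<in> verts (fst X)" for u v
    using f that by (simp add: rooted_iso_def)
  have z: "nedges (fst X) u v = 0" if "u \<notin> verts (fst X) \<or> v \<notin> verts (fst X)" for u v
    using wf_adj[OF wf(1), of u v] that by (auto simp: adj_def)
  have "nedges (fst X) u u = 0" for u
    using m[of u u] z[of u u] t by (cases "u \<in> verts (fst X)") (auto simp: is_tree_def simple_graph_def loop_free_def)
  moreover have "nedges (fst X) u v \<le> 1" for u v
    using m[of u v] z[of u v] t
    by (cases "u \<in> verts (fst X) \<and> v \<in> verts (fst X)") (auto simp: is_tree_def simple_graph_def)
  moreover have "\<not> is_cycle (fst X) c" for c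
  proof
    assume c: "is_cycle (fst X) c"
    have sub: "set c \<subseteq> verts (fst X)"
      using c wf_adj[OF wf(1)] by (fastforce simp: is_cycle_def set_conv_nth)
    have inj: "inj_on f (set c)"
      using f sub by (auto simp: rooted_iso_def bij_betw_def intro: inj_on_subset)
    have "(f (c ! i), f (c ! (Suc i mod length c))) \<in> adj (fst Y)" if "i < length c" for i
    proof -
      have "c ! i \<in> verts (fst X)" "c ! (Suc i mod length c) \<in> verts (fst X)"
        using sub that by (auto intro!: subsetD[OF sub] nth_mem mod_less_divisor)
      then show ?thesis using c that m by (auto simp: is_cycle_def adj_def)
    qed
    moreover have "Suc i mod length c < length c" if "i < length c" for i
      using that by (intro mod_less_divisor) auto
    ultimately have "is_cycle (fst Y) (map f c)"
      using c inj by (auto simp: is_cycle_def distinct_map)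
    then show False using t by (auto simp: is_tree_def)
  qed
  ultimately show ?thesis
    using X by (auto simp: is_tree_def simple_graph_def loop_free_def rooted_graph_def)
qed

lemma admissible_tree_iso:
  assumes X: "rooted_graph X" and Y: "rooted_graph Y" and iso: "isomorphic X Y"
    and t: "admissible_tree ex Y"
  shows "admissible_tree ex X"
proof -
  obtain f where f: "rooted_iso f X Y" using iso by (auto simp: isomorphic_def)
  have wf: "wf_graph (fst X)" "wf_graph (fst Y)" "snd X \<in> verts (fst X)"
    using X Y by (auto simp: rooted_graph_def)
  have b: "bij_betw f (verts (fst X)) (verts (fst Y))" and fr: "f (snd X) = snd Y"
    using f by (auto simp: rooted_iso_def)
  have tr: "is_tree (fst X)" using is_tree_iso[OF X Y iso] t by (cases ex) auto
  show ?thesis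
  proof (cases ex)
    case NonBacktracking
    have "offspring X v \<noteq> {}" if "v \<in> verts (fst X)" for v
    proof
      assume "offspring X v = {}"
      then have "offspring Y (f v) = {}" using offspring_iso[OF wf(1,2) f wf(3) that] by simp
      moreover have "f v \<in> verts (fst Y)" using b that by (auto simp: bij_betw_def)
      ultimately show False using t NonBacktracking by simp
    qed
    then show ?thesis using tr t NonBacktracking bij_betw_finite[OF b] by simp
  next
    case Backtracking
    have "verts (fst X) \<noteq> {snd X}"
    proof
      assume "verts (fst X) = {snd X}"
      then have "verts (fst Y) = {snd Y}" using b fr by (auto simp: bij_betw_def)
      then show False using t Backtracking by simp
    qed
    then show ?thesis using tr Backtracking by simp
  qed
qed

lift_definition limit_tree :: "exploration \<Rightarrow> rgraph \<Rightarrow> bool" is admissible_tree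
  using admissible_tree_iso isomorphic_sym unfolding rooted_graph_def by blast

lift_definition root_bias :: "exploration \<Rightarrow> nat \<Rightarrow> rgraph \<Rightarrow> real" is root_bias_rep
  using root_bias_rep_iso by blast

subsection \<open>Finite graphs\<close>

fun min_order :: "exploration \<Rightarrow> nat" where
  "min_order NonBacktracking = 3"
| "min_order Backtracking = 2"

fun admissible_graph :: "exploration \<Rightarrow> 'v mgraph \<Rightarrow> bool" where
  "admissible_graph NonBacktracking H \<longleftrightarrow> simple_graph H \<and> (\<forall>v\<in>verts H. 2 \<le> deg H v)"
| "admissible_graph Backtracking H \<longleftrightarrow> loop_free H \<and> (\<forall>v\<in>verts H. deg H v \<noteq> 0)"

definition random_graph :: "exploration \<Rightarrow> nat \<Rightarrow> 'w measure \<Rightarrow> ('w \<Rightarrow> nat mgraph) \<Rightarrow> bool" where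
  "random_graph ex n M G \<longleftrightarrow> prob_space M \<and>
     (\<forall>i\<in>{1..n}. \<forall>j\<in>{1..n}. (\<lambda>\<omega>. nedges (G \<omega>) i j) \<in> M \<rightarrow>\<^sub>M count_space UNIV) \<and>
     (\<forall>\<omega>\<in>space M. wf_graph (G \<omega>) \<and> verts (G \<omega>) = {1..n} \<and> admissible_graph ex (G \<omega>))"

text \<open>The sum runs over the non-backtracking walks of length \<open>k\<close>; it is meaningful for \<open>k \<ge> 1\<close> only.\<close>

definition nb_kernel :: "nat mgraph \<Rightarrow> nat \<Rightarrow> nat \<Rightarrow> nat \<Rightarrow> real" where
  "nb_kernel H k i j =
     (\<Sum>x | x \<in> {0..k} \<rightarrow>\<^sub>E verts H \<and> x 0 = i \<and> x k = j \<and>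
          (\<forall>l\<in>{0..k-1}. (x l, x (l + 1)) \<in> adj H) \<and>
          (\<forall>l\<in>{1..k-1}. x (l - 1) \<noteq> x (l + 1)).
        inverse (real (deg H i) * (\<Prod>l\<in>{1..k-1}. real (deg H (x l)) - 1)))"

definition transition :: "nat mgraph \<Rightarrow> nat \<Rightarrow> nat \<Rightarrow> real" where
  "transition H i j = real (nedges H i j) / real (deg H i)"

text \<open>Powers of a matrix with rows and columns indexed by \<open>V\<close>.\<close>

primrec matrix_power :: "nat set \<Rightarrow> (nat \<Rightarrow> nat \<Rightarrow> real) \<Rightarrow> nat \<Rightarrow> nat \<Rightarrow> nat \<Rightarrow> real" where
  "matrix_power V P 0 i j = (if i = j then 1 else 0)"
| "matrix_power V P (Suc k) i j = (\<Sum>m\<in>V. matrix_power V P k i m * P m j)"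

fun kernel :: "exploration \<Rightarrow> nat mgraph \<Rightarrow> nat \<Rightarrow> nat \<Rightarrow> nat \<Rightarrow> real" where
  "kernel NonBacktracking H k i j = nb_kernel H k i j"
| "kernel Backtracking H k i j = matrix_power (verts H) (transition H) k i j"

definition friendship_bias :: "exploration \<Rightarrow> nat \<Rightarrow> nat mgraph \<Rightarrow> nat \<Rightarrow> real" where
  "friendship_bias ex k H i = (\<Sum>j\<in>verts H. kernel ex H k i j * real (deg H j)) - real (deg H i)"

definition quenched :: "exploration \<Rightarrow> nat \<Rightarrow> nat \<Rightarrow> nat mgraph \<Rightarrow> real measure" where
  "quenched ex k n H = measure_of UNIV (sets borel)
     (\<lambda>A. (\<Sum>i\<in>{1..n}. emeasure (return borel (friendship_bias ex k H i)) A) / of_nat n)"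

definition annealed ::
    "exploration \<Rightarrow> nat \<Rightarrow> nat \<Rightarrow> 'w measure \<Rightarrow> ('w \<Rightarrow> nat mgraph) \<Rightarrow> real measure" where
  "annealed ex k n M G = measure_of UNIV (sets borel)
     (\<lambda>A. \<integral>\<^sup>+\<omega>. emeasure (quenched ex k n (G \<omega>)) A \<partial>M)"

definition limit_bias_law :: "exploration \<Rightarrow> nat \<Rightarrow> rgraph measure \<Rightarrow> real measure" where
  "limit_bias_law ex k \<Lambda> = distr \<Lambda> borel (root_bias ex k)"

subsection \<open>Modes of convergence\<close>

definition converges_in_prob ::
    "(nat \<Rightarrow> 'w measure) \<Rightarrow> (nat \<Rightarrow> 'w \<Rightarrow> real) \<Rightarrow> (nat \<Rightarrow> 'w \<Rightarrow> real) \<Rightarrow> bool" where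
  "converges_in_prob M X Y \<longleftrightarrow>
     (\<forall>\<epsilon>>0. (\<lambda>n. measure (M n) {\<omega> \<in> space (M n). \<bar>X n \<omega> - Y n \<omega>\<bar> > \<epsilon>}) \<longlonglongrightarrow> 0)"

definition weakly_converges_in_prob ::
    "(nat \<Rightarrow> 'w measure) \<Rightarrow> (nat \<Rightarrow> 'w \<Rightarrow> real measure) \<Rightarrow> (nat \<Rightarrow> 'w \<Rightarrow> real measure) \<Rightarrow> bool" where
  "weakly_converges_in_prob M \<nu> \<nu>' \<longleftrightarrow>
     (\<forall>f::real \<Rightarrow> real. continuous_on UNIV f \<and> bounded (range f) \<longrightarrow>
        converges_in_prob M (\<lambda>n \<omega>. integral\<^sup>L (\<nu> n \<omega>) f) (\<lambda>n \<omega>. integral\<^sup>L (\<nu>' n \<omega>) f))"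

definition weakly_converges :: "(nat \<Rightarrow> real measure) \<Rightarrow> real measure \<Rightarrow> bool" where
  "weakly_converges \<nu> \<nu>' \<longleftrightarrow>
     (\<forall>f::real \<Rightarrow> real. continuous_on UNIV f \<and> bounded (range f) \<longrightarrow>
        (\<lambda>n. integral\<^sup>L (\<nu> n) f) \<longlonglongrightarrow> integral\<^sup>L \<nu>' f)"

definition component :: "nat mgraph \<Rightarrow> nat \<Rightarrow> rgraph" where
  "component H i = abs_rgraph (induced H {v. (i, v) \<in> (adj H)\<^sup>*}, i)"

definition converges_locally_weakly ::
    "(nat \<Rightarrow> 'w measure) \<Rightarrow> (nat \<Rightarrow> 'w \<Rightarrow> nat mgraph) \<Rightarrow> rgraph measure \<Rightarrow> bool" where
  "converges_locally_weakly M G \<Lambda> \<longleftrightarrow>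
     (\<forall>h::rgraph \<Rightarrow> real. continuous_on UNIV h \<and> bounded (range h) \<longrightarrow>
        (\<lambda>n. \<integral>\<omega>. (\<Sum>i\<in>{1..n}. h (component (G n \<omega>) i)) / real n \<partial>M n) \<longlonglongrightarrow> integral\<^sup>L \<Lambda> h)"

text \<open>
  The limit law \<open>\<Lambda>\<close> may be random. As the graphs live on different probability spaces, it is
  given by a version \<open>\<Lambda> n\<close> on each of them; \<open>random_limit_law\<close> below requires all versions to have
  the same distribution. If all the probability spaces coincide, \<open>\<Lambda> n\<close> may be taken independent
  of \<open>n\<close>. For a random law, the limit of the deterministic numbers \<open>measure (annealed \<dots>) A\<close> is the
  expectation of the random number \<open>measure (limit_bias_law ex k (\<Lambda> n \<omega>)) A\<close>.
\<close>

definition converges_locally_in_prob ::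
    "(nat \<Rightarrow> 'w measure) \<Rightarrow> (nat \<Rightarrow> 'w \<Rightarrow> nat mgraph) \<Rightarrow> (nat \<Rightarrow> 'w \<Rightarrow> rgraph measure) \<Rightarrow> bool" where
  "converges_locally_in_prob M G \<Lambda> \<longleftrightarrow>
     (\<forall>h::rgraph \<Rightarrow> real. continuous_on UNIV h \<and> bounded (range h) \<longrightarrow>
        converges_in_prob M (\<lambda>n \<omega>. (\<Sum>i\<in>{1..n}. h (component (G n \<omega>) i)) / real n)
          (\<lambda>n \<omega>. integral\<^sup>L (\<Lambda> n \<omega>) h))"

definition limit_law :: "exploration \<Rightarrow> rgraph measure \<Rightarrow> bool" where
  "limit_law ex \<Lambda> \<longleftrightarrow> prob_space \<Lambda> \<and> sets \<Lambda> = sets borel \<and> (AE x in \<Lambda>. limit_tree ex x)"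

text \<open>\<open>L\<close> is the distribution of the random law \<open>\<Lambda>\<close>.\<close>

definition random_limit_law ::
    "exploration \<Rightarrow> (nat \<Rightarrow> 'w measure) \<Rightarrow> (nat \<Rightarrow> 'w \<Rightarrow> rgraph measure) \<Rightarrow> rgraph measure measure \<Rightarrow> bool"
where
  "random_limit_law ex M \<Lambda> L \<longleftrightarrow>
     (\<forall>n\<ge>min_order ex. \<Lambda> n \<in> M n \<rightarrow>\<^sub>M prob_algebra borel \<and> distr (M n) (prob_algebra borel) (\<Lambda> n) = L) \<and>
     (AE \<nu> in L. limit_law ex \<nu>)"

end

theory Submission
  imports Defs
begin

text \<open>
  The friendship bias of a vertex after \<open>k\<close> steps is determined by the ball of radius \<open>k + 1\<close> around
  the vertex: the walk stays within distance \<open>k\<close>, and the degree of its endpoint is seen one layer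
  further out. On the space of rooted graphs, two points at distance less than \<open>1 / (1 + k)\<close> have
  isomorphic balls of radius \<open>k + 1\<close>. A function of the bias is thus locally constant, and in
  particular continuous, whatever the function is. So for every bounded Borel \<open>f\<close> (bounded
  continuous functions and indicators alike) the composition of \<open>f\<close> with the bias is an admissible
  test function for local convergence, and all claims are instances of the hypothesis.

  To make this precise, \<open>local_bias\<close> extends the bias to all rooted graphs by averaging operators
  that mimic one step of the exploration. The argument then rests on three facts.

  \<^item> It only depends on the ball (\<open>local_bias_rball\<close>) and is invariant under isomorphism
    (\<open>local_bias_iso\<close>), hence it lives on the quotient and is continuous after composition with any
    \<open>f\<close> (\<open>continuous_on_local_bias_comp\<close>).
  \<^item> On a finite graph it is the friendship bias (\<open>friendship_bias_component\<close>): the iterated averages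
    sum out the last step of a walk, one at a time.
  \<^item> On a limit tree it is the root bias (\<open>root_bias_limit_tree\<close>). For the non-backtracking walk this
    uses that the offspring of a vertex are its neighbours other than its parent, which is where
    acyclicity enters (\<open>tree_neighbour_of_child\<close>).

  Integrals with respect to the quenched law are therefore averages over vertices of a continuous
  function of the component (\<open>integral_quenched\<close>), and those with respect to the limit law are
  integrals of the same function (\<open>integral_limit_bias_law\<close>). The annealed law is a mixture of the
  quenched ones (\<open>annealed_eq_bind\<close>); convergence of its masses follows from convergence in
  probability by boundedness (\<open>expectation_tendsto_if_in_prob\<close>).
\<close>

section \<open>Averaging operators\<close>

text \<open>
  For the two averaging operators below, a function of the current position (backtracking) or of
  the last two positions (non-backtracking) is replaced by its conditional expectation one step
  earlier. Iterating them on the degree function computes the expected degree at the end of the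
  exploration from the root outwards, so that only finitely many generations are ever seen.
\<close>

definition bt_mean :: "'v mgraph \<Rightarrow> ('v \<Rightarrow> real) \<Rightarrow> 'v \<Rightarrow> real" where
  "bt_mean H g v = (\<Sum>w\<in>neighbours H v. real (nedges H v w) / real (deg H v) * g w)"

definition nb_mean :: "'v mgraph \<Rightarrow> ('v \<Rightarrow> 'v \<Rightarrow> real) \<Rightarrow> 'v \<Rightarrow> 'v \<Rightarrow> real" where
  "nb_mean H g u v = (\<Sum>w\<in>neighbours H v - {u}. g v w) / (real (deg H v) - 1)"

text \<open>
  The friendship bias as a function of an arbitrary rooted graph, tree or not. It is the common
  expression for the bias of a vertex of a finite graph and of the root of a limit tree. In the
  non-backtracking case the first step has no predecessor and is averaged separately, which leaves
  \<open>k - 1\<close> steps for \<open>nb_mean\<close>.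
\<close>

fun local_bias :: "exploration \<Rightarrow> nat \<Rightarrow> 'v rooted \<Rightarrow> real" where
  "local_bias NonBacktracking k X =
     (\<Sum>w\<in>neighbours (fst X) (snd X). (nb_mean (fst X) ^^ (k - 1)) (\<lambda>_ v. real (deg (fst X) v)) (snd X) w)
       / real (deg (fst X) (snd X)) - real (deg (fst X) (snd X))"
| "local_bias Backtracking k X =
     (bt_mean (fst X) ^^ k) (\<lambda>v. real (deg (fst X) v)) (snd X) - real (deg (fst X) (snd X))"

text \<open>
  The one-step average for the walk of the limit object, which on non-trees may differ from
  \<open>bt_mean\<close> and \<open>nb_mean\<close>: it counts neighbours without multiplicity and recognises the way back by
  the distance to the root.
\<close>

definition step_mean :: "exploration \<Rightarrow> 'v rooted \<Rightarrow> ('v \<Rightarrow> real) \<Rightarrow> 'v \<Rightarrow> real" where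
  "step_mean ex X g v = (if walk_moves ex X v = {} then g v
     else (\<Sum>w\<in>walk_moves ex X v. g w) / real (card (walk_moves ex X v)))"

section \<open>Locality of the bias\<close>

text \<open>
  The ball of radius \<open>m\<close> around \<open>v\<close> lies in \<open>S\<close>. This covers at once the two subgraphs of
  interest: a ball around the root, where the admissible radius shrinks along the walk, and a
  connected component, which satisfies it for every \<open>m\<close>.
\<close>

definition reach_within :: "'v mgraph \<Rightarrow> 'v set \<Rightarrow> nat \<Rightarrow> 'v \<Rightarrow> bool" where
  "reach_within H S m v \<longleftrightarrow> (\<forall>j\<le>m. \<forall>w. (v, w) \<in> adj H ^^ j \<longrightarrow> w \<in> S)"

lemma reach_within_mono: "reach_within H S m v \<Longrightarrow> l \<le> m \<Longrightarrow> reach_within H S l v"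
  unfolding reach_within_def by (meson le_trans)

lemma reach_within_self: "reach_within H S m v \<Longrightarrow> v \<in> S"
  unfolding reach_within_def by (metis le0 relpow_0_I)

lemma reach_within_neighbour:
  assumes "reach_within H S (Suc m) v" "w \<in> neighbours H v" shows "reach_within H S m w"
  unfolding reach_within_def
proof (intro allI impI)
  fix j u assume j: "j \<le> m" and u: "(w, u) \<in> adj H ^^ j"
  have "(v, w) \<in> adj H" using assms(2) by (simp add: neighbours_def)
  then have "(v, u) \<in> adj H ^^ Suc j" by (rule relpow_Suc_I2[OF _ u])
  moreover have "Suc j \<le> Suc m" using j by simp
  ultimately show "u \<in> S" using assms(1) unfolding reach_within_def by blast
qed

text \<open>
  One spare unit of radius keeps all edges at \<open>v\<close> inside \<open>S\<close>, so that \<open>v\<close> has the same degree and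
  the same neighbours in the induced subgraph.
\<close>

lemma reach_within_induced:
  assumes "reach_within H S (Suc m) v"
  shows "neighbours (induced H S) v = neighbours H v" "deg (induced H S) v = deg H v"
    "\<And>w. w \<in> neighbours H v \<Longrightarrow> nedges (induced H S) v w = nedges H v w"
proof -
  have v: "v \<in> S" by (rule reach_within_self[OF assms])
  have w: "w \<in> S" if "w \<in> neighbours H v" for w
    by (rule reach_within_self[OF reach_within_neighbour[OF assms that]])
  show e: "nedges (induced H S) v w = nedges H v w" if "w \<in> neighbours H v" for w
    using v w[OF that] by (simp add: induced_def)
  show n: "neighbours (induced H S) v = neighbours H v"
    using v w by (auto simp: neighbours_def induced_def adj_def)
  show "deg (induced H S) v = deg H v" by (simp add: deg_def n e)
qed

lemma bt_mean_induced:
  "reach_within H S (Suc m) v \<Longrightarrow>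
    (bt_mean (induced H S) ^^ m) (\<lambda>v. real (deg (induced H S) v)) v = (bt_mean H ^^ m) (\<lambda>v. real (deg H v)) v"
proof (induction m arbitrary: v)
  case (Suc m)
  have "reach_within H S (Suc m) w" if "w \<in> neighbours H v" for w
    using reach_within_neighbour[OF Suc.prems that] .
  then show ?case
    using reach_within_induced[OF Suc.prems] Suc.IH by (simp add: bt_mean_def)
qed (simp add: reach_within_induced)

lemma nb_mean_induced:
  "reach_within H S (Suc m) v \<Longrightarrow>
    (nb_mean (induced H S) ^^ m) (\<lambda>_ v. real (deg (induced H S) v)) u v
      = (nb_mean H ^^ m) (\<lambda>_ v. real (deg H v)) u v"
proof (induction m arbitrary: u v)
  case (Suc m)
  have "reach_within H S (Suc m) w" if "w \<in> neighbours H v" for w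
    using reach_within_neighbour[OF Suc.prems that] .
  then show ?case
    using reach_within_induced[OF Suc.prems] Suc.IH by (simp add: nb_mean_def)
qed (simp add: reach_within_induced)

text \<open>
  The walk makes \<open>k\<close> steps, and the degree of its endpoint needs one further layer.
\<close>

lemma local_bias_induced:
  assumes "k \<ge> 1" "reach_within H S (Suc k) v"
  shows "local_bias ex k (induced H S, v) = local_bias ex k (H, v)"
proof (cases ex)
  case NonBacktracking
  have "reach_within H S (Suc (k - 1)) w" if "w \<in> neighbours H v" for w
    using reach_within_neighbour[OF assms(2) that] assms(1) by simp
  then show ?thesis
    using nb_mean_induced[of H S "k - 1"] reach_within_induced[OF assms(2)] NonBacktracking by simp
next
  case Backtracking
  then show ?thesis
    using bt_mean_induced[OF assms(2)] reach_within_induced[OF assms(2)] by simp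
qed

lemma reach_within_rball: "reach_within (fst X) {v. gdist (fst X) (snd X) v \<le> enat r} r (snd X)"
  unfolding reach_within_def by (auto simp: gdist_le_iff)

lemma local_bias_rball: "k \<ge> 1 \<Longrightarrow> local_bias ex k (rball (Suc k) X) = local_bias ex k X"
  unfolding rball_def using local_bias_induced[OF _ reach_within_rball, of k ex X] by simp

lemma gdist_rball:
  assumes "gdist (fst X) (snd X) v \<le> enat r"
  shows "gdist (fst (rball r X)) (snd X) v = gdist (fst X) (snd X) v"
proof -
  have *: "gdist (fst (rball r X)) (snd X) v \<le> enat s \<longleftrightarrow> gdist (fst X) (snd X) v \<le> enat s" if "s \<le> r" for s
    unfolding gdist_le_iff using relpow_rball relpow_rball_D that by (metis le_trans)
  obtain d where d: "gdist (fst X) (snd X) v = enat d" "d \<le> r"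
    using assms by (cases "gdist (fst X) (snd X) v") auto
  obtain d' where d': "gdist (fst (rball r X)) (snd X) v = enat d'" "d' \<le> r"
    using assms *[of r] by (cases "gdist (fst (rball r X)) (snd X) v") auto
  show ?thesis using *[of d] *[of d'] d d' by auto
qed

text \<open>
  Offspring is defined by distances to the root, which are the same in a ball as in the whole graph.
\<close>

lemma walk_moves_rball:
  assumes "reach_within (fst X) {v. gdist (fst X) (snd X) v \<le> enat r} (Suc m) v"
  shows "walk_moves ex (rball r X) v = walk_moves ex X v"
proof -
  let ?S = "{v. gdist (fst X) (snd X) v \<le> enat r}"
  have n: "neighbours (fst (rball r X)) v = neighbours (fst X) v"
    using reach_within_induced(1)[OF assms] by (simp add: rball_def)
  have "gdist (fst (rball r X)) (snd X) v = gdist (fst X) (snd X) v"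
    using reach_within_self[OF assms] by (intro gdist_rball) simp
  moreover have "gdist (fst (rball r X)) (snd X) w = gdist (fst X) (snd X) w" if "w \<in> neighbours (fst X) v" for w
    using reach_within_self[OF reach_within_neighbour[OF assms that]] by (intro gdist_rball) simp
  ultimately show ?thesis
    using n by (cases ex) (auto simp: offspring_def)
qed

lemma step_mean_rball:
  "reach_within (fst X) {v. gdist (fst X) (snd X) v \<le> enat r} (Suc m) v \<Longrightarrow>
    (step_mean ex (rball r X) ^^ m) (\<lambda>v. real (deg (fst (rball r X)) v)) v
      = (step_mean ex X ^^ m) (\<lambda>v. real (deg (fst X) v)) v"
proof (induction m arbitrary: v)
  case 0
  then show ?case using reach_within_induced(2)[OF 0] by (simp add: rball_def)
next
  case (Suc m)
  have "walk_moves ex X v \<subseteq> neighbours (fst X) v" by (cases ex) (auto simp: offspring_def)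
  then have "reach_within (fst X) {v. gdist (fst X) (snd X) v \<le> enat r} (Suc m) w" if "w \<in> walk_moves ex X v" for w
    using reach_within_neighbour[OF Suc.prems] that by blast
  moreover have "reach_within (fst X) {v. gdist (fst X) (snd X) v \<le> enat r} (Suc m) v"
    using reach_within_mono[OF Suc.prems] by simp
  ultimately show ?case
    using walk_moves_rball[OF Suc.prems] Suc.IH by (simp add: step_mean_def)
qed

lemma integral_measure_pmf_finite_bind:
  fixes g :: "'a \<Rightarrow> real"
  assumes "finite (set_pmf p)" "\<And>x. x \<in> set_pmf p \<Longrightarrow> finite (set_pmf (q x))"
  shows "measure_pmf.expectation (bind_pmf p q) g
    = measure_pmf.expectation p (\<lambda>x. measure_pmf.expectation (q x) g)"
  by (simp add: pmf_expectation_bind[OF assms order_refl] integral_measure_pmf[OF assms(1)])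

lemma finite_tree_walk:
  assumes "rooted_graph X" shows "finite (set_pmf (tree_walk ex X k))"
  by (induction k) (use walk_moves_finite[OF assms, of ex] in auto)

text \<open>
  The walk is built by appending steps, while \<open>step_mean\<close> is applied to the function being averaged;
  since local finiteness makes all distributions finitely supported, the two are dual.
\<close>

lemma tree_walk_expectation:
  assumes "rooted_graph X"
  shows "measure_pmf.expectation (tree_walk ex X k) g = (step_mean ex X ^^ k) g (snd X)"
proof (induction k arbitrary: g)
  case (Suc k)
  let ?q = "\<lambda>v. if walk_moves ex X v = {} then return_pmf v else pmf_of_set (walk_moves ex X v)"
  have f: "finite (walk_moves ex X v)" for v by (rule walk_moves_finite[OF assms])
  have "measure_pmf.expectation (tree_walk ex X (Suc k)) g
      = measure_pmf.expectation (tree_walk ex X k) (\<lambda>v. measure_pmf.expectation (?q v) g)"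
    unfolding tree_walk.simps
    by (rule integral_measure_pmf_finite_bind[OF finite_tree_walk[OF assms]]) (simp add: f)
  also have "(\<lambda>v. measure_pmf.expectation (?q v) g) = step_mean ex X g"
    using f by (auto simp: step_mean_def fun_eq_iff integral_pmf_of_set)
  finally show ?case by (simp add: Suc.IH funpow_swap1)
qed simp

lemma root_bias_rep_eq:
  assumes "rooted_graph X"
  shows "root_bias_rep ex k X
    = (step_mean ex X ^^ k) (\<lambda>v. real (deg (fst X) v)) (snd X) - real (deg (fst X) (snd X))"
proof -
  let ?p = "tree_walk ex X k" and ?d = "\<lambda>v. real (deg (fst X) v)"
  have "(\<Sum>\<^sub>\<infinity>j\<in>verts (fst X). pmf ?p j * ?d j) = (\<Sum>\<^sub>\<infinity>j\<in>set_pmf ?p. pmf ?p j * ?d j)"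
    using tree_walk_verts[OF assms, of ex k] by (intro infsum_cong_neutral) (auto simp: set_pmf_iff)
  also have "\<dots> = (\<Sum>j\<in>set_pmf ?p. pmf ?p j * ?d j)"
    by (rule infsum_finite[OF finite_tree_walk[OF assms]])
  also have "\<dots> = measure_pmf.expectation ?p ?d"
    by (subst integral_measure_pmf[OF finite_tree_walk[OF assms]]) auto
  finally show ?thesis by (simp add: root_bias_rep_def tree_walk_expectation[OF assms])
qed

lemma sym_adj: "wf_graph H \<Longrightarrow> sym (adj H)"
  by (auto simp: sym_def adj_def) (metis wf_graph_def)

text \<open>
  Common criterion for balls and components to represent points of the space of rooted graphs.
\<close>

lemma rooted_graph_induced_reachable:
  assumes "wf_graph H" "locally_finite H" "v \<in> verts H" "v \<in> S"
    and reach: "\<And>w. w \<in> verts H \<inter> S \<Longrightarrow> (v, w) \<in> (adj (induced H S))\<^sup>*"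
  shows "rooted_graph (induced H S, v)"
  unfolding rooted_graph_def fst_conv snd_conv
proof (intro conjI)
  show wf: "wf_graph (induced H S)" by (rule wf_induced[OF assms(1)])
  show "connected_graph (induced H S)"
    unfolding connected_graph_def
  proof (intro ballI)
    fix a b assume "a \<in> verts (induced H S)" "b \<in> verts (induced H S)"
    then have "(v, a) \<in> (adj (induced H S))\<^sup>*" "(v, b) \<in> (adj (induced H S))\<^sup>*"
      using reach by (auto simp: induced_def)
    then show "(a, b) \<in> (adj (induced H S))\<^sup>*"
      using sym_rtrancl[OF sym_adj[OF wf]] by (meson rtrancl_trans symD)
  qed
  have "neighbours (induced H S) u \<subseteq> neighbours H u" for u
    by (auto simp: neighbours_def adj_def induced_def split: if_splits)
  then show "locally_finite (induced H S)"
    using assms(2) unfolding locally_finite_def by (meson finite_subset)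
  show "v \<in> verts (induced H S)" using assms by (simp add: induced_def)
qed

lemma rooted_graph_rball:
  assumes "rooted_graph X" shows "rooted_graph (rball r X)"
proof -
  have "(snd X, w) \<in> (adj (fst (rball r X)))\<^sup>*" if "gdist (fst X) (snd X) w \<le> enat r" for w
    using that relpow_rball[where X = X and r = r] unfolding gdist_le_iff by (meson relpow_imp_rtrancl)
  then show ?thesis
    using assms unfolding rball_def
    by (intro rooted_graph_induced_reachable) (auto simp: rooted_graph_def)
qed

text \<open>
  Locality holds on all rooted graphs and not only on trees, which makes \<open>root_bias\<close> continuous on
  the whole space. This is used for its Borel measurability, without which the push-forward
  \<open>limit_bias_law\<close> would be meaningless.
\<close>

lemma root_bias_rep_rball:
  assumes "rooted_graph X" shows "root_bias_rep ex k (rball (Suc k) X) = root_bias_rep ex k X"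
proof -
  have "reach_within (fst X) {v. gdist (fst X) (snd X) v \<le> enat (Suc k)} (Suc k) (snd X)"
    by (rule reach_within_rball)
  from step_mean_rball[OF this] reach_within_induced(2)[OF this] show ?thesis
    unfolding root_bias_rep_eq[OF assms] root_bias_rep_eq[OF rooted_graph_rball[OF assms]]
    by (simp add: rball_def)
qed

lemma component_rooted_graph:
  assumes "wf_graph H" "locally_finite H" "i \<in> verts H"
  shows "rooted_graph (induced H {v. (i, v) \<in> (adj H)\<^sup>*}, i)"
proof (rule rooted_graph_induced_reachable[OF assms])
  let ?S = "{v. (i, v) \<in> (adj H)\<^sup>*}"
  fix w assume "w \<in> verts H \<inter> ?S"
  then have "(i, w) \<in> (adj H)\<^sup>*" by simp
  then show "(i, w) \<in> (adj (induced H ?S))\<^sup>*"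
  proof (induction rule: rtrancl_induct)
    case (step y z)
    then have "(y, z) \<in> adj (induced H ?S)"
      by (auto simp: adj_def induced_def intro: rtrancl_into_rtrancl)
    then show ?case using step by (meson rtrancl_into_rtrancl)
  qed simp
qed simp

lemma local_bias_component:
  "k \<ge> 1 \<Longrightarrow> local_bias ex k (induced H {v. (i, v) \<in> (adj H)\<^sup>*}, i) = local_bias ex k (H, i)"
  by (rule local_bias_induced) (auto simp: reach_within_def dest: relpow_imp_rtrancl)

section \<open>Isomorphism invariance and continuity\<close>

lemma bt_mean_transport:
  assumes wf: "wf_graph (fst X)" "wf_graph (fst Y)" and f: "rooted_iso f X Y"
    and g: "\<And>w. w \<in> verts (fst X) \<Longrightarrow> g' (f w) = g w" and v: "v \<in> verts (fst X)"
  shows "bt_mean (fst Y) g' (f v) = bt_mean (fst X) g v"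
proof -
  have sub: "neighbours (fst X) v \<subseteq> verts (fst X)" by (rule neighbours_verts[OF wf(1)])
  have inj: "inj_on f (neighbours (fst X) v)"
    using f sub by (auto simp: rooted_iso_def bij_betw_def intro: inj_on_subset)
  have "nedges (fst Y) (f v) (f w) = nedges (fst X) v w" if "w \<in> neighbours (fst X) v" for w
    using f v that sub by (auto simp: rooted_iso_def)
  then show ?thesis
    using sub g by (simp add: bt_mean_def neighbours_iso[OF wf f v] sum.reindex[OF inj]
        deg_iso[OF wf f v] subset_iff cong: sum.cong)
qed

lemma bt_mean_iso:
  assumes wf: "wf_graph (fst X)" "wf_graph (fst Y)" and f: "rooted_iso f X Y"
  shows "v \<in> verts (fst X) \<Longrightarrow>
    (bt_mean (fst Y) ^^ m) (\<lambda>v. real (deg (fst Y) v)) (f v) = (bt_mean (fst X) ^^ m) (\<lambda>v. real (deg (fst X) v)) v"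
  by (induction m arbitrary: v) (simp_all add: deg_iso[OF wf f] bt_mean_transport[OF wf f])

lemma nb_mean_transport:
  assumes wf: "wf_graph (fst X)" "wf_graph (fst Y)" and f: "rooted_iso f X Y"
    and g: "\<And>v w. v \<in> verts (fst X) \<Longrightarrow> w \<in> verts (fst X) \<Longrightarrow> g' (f v) (f w) = g v w"
    and u: "u \<in> verts (fst X)" and v: "v \<in> verts (fst X)"
  shows "nb_mean (fst Y) g' (f u) (f v) = nb_mean (fst X) g u v"
proof -
  have sub: "neighbours (fst X) v \<subseteq> verts (fst X)" by (rule neighbours_verts[OF wf(1)])
  have inj: "inj_on f (verts (fst X))" using f by (simp add: rooted_iso_def bij_betw_def)
  then have eq: "f ` neighbours (fst X) v - {f u} = f ` (neighbours (fst X) v - {u})"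
    using sub u by (auto simp: inj_on_def)
  have inj': "inj_on f (neighbours (fst X) v - {u})"
    using sub by (intro inj_on_subset[OF inj]) auto
  have "(\<Sum>w\<in>neighbours (fst X) v - {u}. g' (f v) (f w)) = (\<Sum>w\<in>neighbours (fst X) v - {u}. g v w)"
    using sub g v by (intro sum.cong) auto
  then show ?thesis
    by (simp add: nb_mean_def neighbours_iso[OF wf f v] eq sum.reindex[OF inj'] deg_iso[OF wf f v])
qed

lemma nb_mean_iso:
  assumes wf: "wf_graph (fst X)" "wf_graph (fst Y)" and f: "rooted_iso f X Y"
  shows "u \<in> verts (fst X) \<Longrightarrow> v \<in> verts (fst X) \<Longrightarrow>
    (nb_mean (fst Y) ^^ m) (\<lambda>_ v. real (deg (fst Y) v)) (f u) (f v)
      = (nb_mean (fst X) ^^ m) (\<lambda>_ v. real (deg (fst X) v)) u v"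
  by (induction m arbitrary: u v) (simp_all add: deg_iso[OF wf f] nb_mean_transport[OF wf f])

lemma local_bias_iso:
  assumes X: "rooted_graph X" and Y: "rooted_graph Y" and iso: "isomorphic X Y"
  shows "local_bias ex k X = local_bias ex k Y"
proof -
  obtain f where f: "rooted_iso f X Y" using iso by (auto simp: isomorphic_def)
  have wf: "wf_graph (fst X)" "wf_graph (fst Y)" "snd X \<in> verts (fst X)"
    using X Y by (auto simp: rooted_graph_def)
  have fr: "snd Y = f (snd X)" using f by (simp add: rooted_iso_def)
  have sub: "neighbours (fst X) (snd X) \<subseteq> verts (fst X)" by (rule neighbours_verts[OF wf(1)])
  have inj: "inj_on f (neighbours (fst X) (snd X))"
    using f sub by (auto simp: rooted_iso_def bij_betw_def intro: inj_on_subset)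
  show ?thesis
    using sub wf(3)
    by (cases ex) (simp_all add: fr neighbours_iso[OF wf(1,2) f wf(3)] sum.reindex[OF inj] deg_iso[OF wf(1,2) f]
        nb_mean_iso[OF wf(1,2) f] bt_mean_iso[OF wf(1,2) f] subset_iff cong: sum.cong)
qed

lift_definition local_bias_class :: "exploration \<Rightarrow> nat \<Rightarrow> rgraph \<Rightarrow> real" is local_bias
  using local_bias_iso by blast

lemma dist_rgraph_less_D:
  assumes "rooted_graph X" "rooted_graph Y" "rooted_dist X Y < 1 / (1 + real r)"
  shows "isomorphic (rball (Suc r) X) (rball (Suc r) Y)"
  using assms rooted_dist_ge_iff[of X Y r] by (simp add: rooted_graph_def)

text \<open>
  The metric takes the values \<open>1 / (1 + r)\<close> and 0, and being closer than \<open>1 / (1 + r)\<close> means to have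
  isomorphic balls of radius \<open>r + 1\<close>.
\<close>

lemma continuous_on_if_locally_constant:
  fixes h :: "rgraph \<Rightarrow> real"
  assumes "\<And>x y. dist x y < 1 / (1 + real r) \<Longrightarrow> h x = h y"
  shows "continuous_on UNIV h"
  unfolding continuous_on_iff
proof (intro ballI allI impI)
  fix x :: rgraph and e :: real assume "e > 0"
  then show "\<exists>d>0. \<forall>x'\<in>UNIV. dist x' x < d \<longrightarrow> dist (h x') (h x) < e"
    using assms by (intro exI[of _ "1 / (1 + real r)"]) auto
qed

lemma local_bias_class_locally_constant:
  assumes "k \<ge> 1"
  shows "dist x y < 1 / (1 + real k) \<Longrightarrow> local_bias_class ex k x = local_bias_class ex k y"
proof (transfer fixing: k ex)
  fix X Y :: "nat rooted"
  assume a: "rooted_graph X \<and> rooted_graph X \<and> isomorphic X X" "rooted_graph Y \<and> rooted_graph Y \<and> isomorphic Y Y"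
    "rooted_dist X Y < 1 / (1 + real k)"
  have "local_bias ex k (rball (Suc k) X) = local_bias ex k (rball (Suc k) Y)"
    using a by (intro local_bias_iso rooted_graph_rball dist_rgraph_less_D) auto
  then show "local_bias ex k X = local_bias ex k Y" using assms by (simp add: local_bias_rball)
qed

text \<open>
  A locally constant function stays locally constant under composition with any \<open>f\<close>. Hence
  indicators of Borel sets are as good as continuous functions, and convergence on all Borel sets
  comes for free.
\<close>

lemma continuous_on_local_bias_comp:
  fixes f :: "real \<Rightarrow> real"
  assumes "k \<ge> 1" shows "continuous_on UNIV (\<lambda>x. f (local_bias_class ex k x))"
proof (rule continuous_on_if_locally_constant)
  show "dist x y < 1 / (1 + real k) \<Longrightarrow> f (local_bias_class ex k x) = f (local_bias_class ex k y)" for x y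
    using local_bias_class_locally_constant[OF assms] by metis
qed

lemma root_bias_locally_constant:
  "dist x y < 1 / (1 + real k) \<Longrightarrow> root_bias ex k x = root_bias ex k y"
proof (transfer fixing: k ex)
  fix X Y :: "nat rooted"
  assume a: "rooted_graph X \<and> rooted_graph X \<and> isomorphic X X" "rooted_graph Y \<and> rooted_graph Y \<and> isomorphic Y Y"
    "rooted_dist X Y < 1 / (1 + real k)"
  have "root_bias_rep ex k (rball (Suc k) X) = root_bias_rep ex k (rball (Suc k) Y)"
    using a by (intro root_bias_rep_iso rooted_graph_rball dist_rgraph_less_D) auto
  then show "root_bias_rep ex k X = root_bias_rep ex k Y" using a by (simp add: root_bias_rep_rball)
qed

section \<open>Finite graphs\<close>

text \<open>
  Matrix powers append a step on the right, which amounts to applying the transition matrix to \<open>g\<close> first.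
\<close>

lemma matrix_power_transition:
  assumes "finite (verts H)" "wf_graph H"
  shows "i \<in> verts H \<Longrightarrow>
    (\<Sum>j\<in>verts H. matrix_power (verts H) (transition H) k i j * g j) = (bt_mean H ^^ k) g i"
proof (induction k arbitrary: g)
  case 0
  have "(\<Sum>j\<in>verts H. matrix_power (verts H) (transition H) 0 i j * g j) = (\<Sum>j\<in>verts H. if j = i then g j else 0)"
    by (intro sum.cong) auto
  then show ?case using 0 assms(1) by simp
next
  case (Suc k)
  let ?Q = "matrix_power (verts H) (transition H) k"
  have *: "(\<Sum>j\<in>verts H. transition H m j * g j) = bt_mean H g m" for m
    unfolding bt_mean_def transition_def
    using neighbours_verts[OF assms(2), of m] assms(1)
    by (intro sum.mono_neutral_right) (auto simp: neighbours_def adj_def)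
  have "(\<Sum>j\<in>verts H. matrix_power (verts H) (transition H) (Suc k) i j * g j)
      = (\<Sum>j\<in>verts H. \<Sum>m\<in>verts H. ?Q i m * (transition H m j * g j))"
    by (simp add: sum_distrib_right mult.assoc)
  also have "\<dots> = (\<Sum>m\<in>verts H. ?Q i m * (\<Sum>j\<in>verts H. transition H m j * g j))"
    by (subst sum.swap) (simp add: sum_distrib_left)
  finally show ?case using Suc by (simp add: * funpow_swap1)
qed

text \<open>
  The index set and the weights of the sum defining \<open>nb_kernel\<close>, before fixing the endpoint.
\<close>

definition nb_walks :: "'v mgraph \<Rightarrow> nat \<Rightarrow> 'v \<Rightarrow> (nat \<Rightarrow> 'v) set" where
  "nb_walks H k i = {x \<in> {0..k} \<rightarrow>\<^sub>E verts H. x 0 = i \<and>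
     (\<forall>l\<in>{0..k-1}. (x l, x (l + 1)) \<in> adj H) \<and> (\<forall>l\<in>{1..k-1}. x (l - 1) \<noteq> x (l + 1))}"

definition nb_weight :: "'v mgraph \<Rightarrow> nat \<Rightarrow> (nat \<Rightarrow> 'v) \<Rightarrow> real" where
  "nb_weight H k x = inverse (real (deg H (x 0)) * (\<Prod>l\<in>{1..k-1}. real (deg H (x l)) - 1))"

lemma finite_nb_walks: "finite (verts H) \<Longrightarrow> finite (nb_walks H k i)"
  unfolding nb_walks_def by (rule finite_subset[OF _ finite_PiE[of "{0..k}" "\<lambda>_. verts H"]]) auto

lemma nb_walks_1:
  assumes "wf_graph H" "i \<in> verts H"
  shows "bij_betw (\<lambda>w. (\<lambda>_. undefined)(0 := i, 1 := w)) (neighbours H i) (nb_walks H 1 i)"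
proof (rule bij_betw_byWitness[where f' = "\<lambda>x. x 1"])
  show "\<forall>x\<in>nb_walks H 1 i. (\<lambda>_. undefined)(0 := i, 1 := x 1) = x"
  proof
    fix x assume x: "x \<in> nb_walks H 1 i"
    have "((\<lambda>_. undefined)(0 := i, 1 := x 1)) l = x l" for l
      using x by (cases "l \<in> {0..1}") (auto simp: nb_walks_def PiE_def extensional_def le_Suc_eq)
    then show "(\<lambda>_. undefined)(0 := i, 1 := x 1) = x" by blast
  qed
  show "(\<lambda>w. (\<lambda>_. undefined)(0 := i, 1 := w)) ` neighbours H i \<subseteq> nb_walks H 1 i"
    using assms neighbours_verts[OF assms(1), of i]
    by (auto simp: nb_walks_def PiE_def extensional_def neighbours_def)
  show "(\<lambda>x. x 1) ` nb_walks H 1 i \<subseteq> neighbours H i"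
    by (auto simp: nb_walks_def neighbours_def)
qed simp

text \<open>
  The conditions on a walk are local: appending a vertex adds conditions on the last three vertices only.
\<close>

lemma nb_walks_Suc:
  assumes "wf_graph H" "k \<ge> 1"
  shows "bij_betw (\<lambda>(x, w). x(Suc k := w))
    (SIGMA x:nb_walks H k i. neighbours H (x k) - {x (k - 1)}) (nb_walks H (Suc k) i)"
proof (rule bij_betw_byWitness[where f' = "\<lambda>y. (restrict y {0..k}, y (Suc k))"])
  have ext: "x (Suc k) = undefined" if "x \<in> nb_walks H k i" for x
    using that by (auto simp: nb_walks_def PiE_def extensional_def)
  show "\<forall>p\<in>SIGMA x:nb_walks H k i. neighbours H (x k) - {x (k - 1)}.
     (\<lambda>y. (restrict y {0..k}, y (Suc k))) ((\<lambda>(x, w). x(Suc k := w)) p) = p"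
    by (auto simp: nb_walks_def PiE_def extensional_def restrict_def fun_eq_iff)
  show "\<forall>y\<in>nb_walks H (Suc k) i.
     (\<lambda>(x, w). x(Suc k := w)) ((\<lambda>y. (restrict y {0..k}, y (Suc k))) y) = y"
    by (auto simp: nb_walks_def PiE_def extensional_def restrict_def fun_eq_iff)
  show "(\<lambda>(x, w). x(Suc k := w)) ` (SIGMA x:nb_walks H k i. neighbours H (x k) - {x (k - 1)})
    \<subseteq> nb_walks H (Suc k) i"
  proof (rule image_subsetI)
    fix p assume "p \<in> (SIGMA x:nb_walks H k i. neighbours H (x k) - {x (k - 1)})"
    then obtain x w where p: "p = (x, w)" and x: "x \<in> nb_walks H k i"
      and w: "w \<in> neighbours H (x k)" "w \<noteq> x (k - 1)" by blast
    have adj: "(x l, x (Suc l)) \<in> adj H" if "l < k" for l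
      using x that by (auto simp: nb_walks_def)
    have nb: "x (l - 1) \<noteq> x (Suc l)" if "1 \<le> l" "l < k" for l
      using x that by (auto simp: nb_walks_def)
    have "w \<in> verts H" using w neighbours_verts[OF assms(1)] by blast
    then have "x(Suc k := w) \<in> {0..Suc k} \<rightarrow>\<^sub>E verts H"
      using x by (auto simp: nb_walks_def PiE_def extensional_def Pi_def le_Suc_eq)
    moreover have "(x(Suc k := w)) 0 = i" using x by (simp add: nb_walks_def)
    moreover have "((x(Suc k := w)) l, (x(Suc k := w)) (l + 1)) \<in> adj H" if "l \<le> k" for l
      using adj[of l] that w(1) by (cases "l = k") (auto simp: neighbours_def)
    moreover have "(x(Suc k := w)) (l - 1) \<noteq> (x(Suc k := w)) (l + 1)" if "1 \<le> l" "l \<le> k" for l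
      using nb[of l] that w(2) by (cases "l = k") auto
    ultimately show "(\<lambda>(x, w). x(Suc k := w)) p \<in> nb_walks H (Suc k) i"
      unfolding nb_walks_def p by simp
  qed
  show "(\<lambda>y. (restrict y {0..k}, y (Suc k))) ` nb_walks H (Suc k) i
    \<subseteq> (SIGMA x:nb_walks H k i. neighbours H (x k) - {x (k - 1)})"
  proof (rule image_subsetI)
    fix y assume y: "y \<in> nb_walks H (Suc k) i"
    have adj: "(y l, y (Suc l)) \<in> adj H" if "l \<le> k" for l
      using y that by (auto simp: nb_walks_def)
    have nb: "y (l - 1) \<noteq> y (Suc l)" if "1 \<le> l" "l \<le> k" for l
      using y that by (auto simp: nb_walks_def)
    have "restrict y {0..k} \<in> nb_walks H k i"
      using y adj nb assms(2) by (auto simp: nb_walks_def)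
    moreover have "y (Suc k) \<in> neighbours H (y k)" "y (Suc k) \<noteq> y (k - 1)"
      using adj[of k] nb[of k] assms(2) by (auto simp: neighbours_def)
    ultimately show "(restrict y {0..k}, y (Suc k)) \<in> (SIGMA x:nb_walks H k i. neighbours H (x k) - {x (k - 1)})"
      by auto
  qed
qed

lemma nb_weight_Suc:
  assumes "k \<ge> 1"
  shows "nb_weight H (Suc k) (x(Suc k := w)) = nb_weight H k x / (real (deg H (x k)) - 1)"
proof -
  have "(\<Prod>l\<in>{1..Suc k - 1}. real (deg H ((x(Suc k := w)) l)) - 1) = (\<Prod>l\<in>{1..k}. real (deg H (x l)) - 1)"
    by (intro prod.cong) auto
  also have "{1..k} = insert k {1..k-1}" using assms by auto
  also have "(\<Prod>l\<in>insert k {1..k-1}. real (deg H (x l)) - 1)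
      = (real (deg H (x k)) - 1) * (\<Prod>l\<in>{1..k-1}. real (deg H (x l)) - 1)"
    using assms by (subst prod.insert) auto
  finally show ?thesis
    unfolding nb_weight_def by (simp add: divide_inverse mult.assoc mult.left_commute del: diff_Suc_1)
qed

text \<open>
  The test function \<open>g\<close> depends on the last two vertices because these decide where the walk may go
  next; summing out the last vertex turns \<open>g\<close> into \<open>nb_mean H g\<close>.
\<close>

lemma sum_nb_walks:
  assumes "finite (verts H)" "wf_graph H" "i \<in> verts H"
  shows "(\<Sum>x\<in>nb_walks H (Suc k) i. nb_weight H (Suc k) x * g (x k) (x (Suc k)))
    = (\<Sum>w\<in>neighbours H i. (nb_mean H ^^ k) g i w) / real (deg H i)"
proof (induction k arbitrary: g)
  case 0
  have "(\<Sum>x\<in>nb_walks H 1 i. nb_weight H 1 x * g (x 0) (x 1))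
      = (\<Sum>w\<in>neighbours H i. nb_weight H 1 ((\<lambda>_. undefined)(0 := i, 1 := w)) * g i w)"
    by (subst sum.reindex_bij_betw[OF nb_walks_1[OF assms(2,3)], symmetric]) simp
  then show ?case by (simp add: nb_weight_def divide_inverse sum_distrib_left sum_distrib_right mult.commute)
next
  case (Suc k)
  let ?N = "\<lambda>x. neighbours H (x (Suc k)) - {x k}"
  have fin: "finite (neighbours H v)" for v
    using neighbours_verts[OF assms(2)] assms(1) finite_subset by blast
  have "(\<Sum>y\<in>nb_walks H (Suc (Suc k)) i. nb_weight H (Suc (Suc k)) y * g (y (Suc k)) (y (Suc (Suc k))))
      = (\<Sum>(x, w)\<in>(SIGMA x:nb_walks H (Suc k) i. ?N x).
          nb_weight H (Suc k) x / (real (deg H (x (Suc k))) - 1) * g (x (Suc k)) w)"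
    by (subst sum.reindex_bij_betw[OF nb_walks_Suc[OF assms(2)], symmetric])
       (auto intro!: sum.cong simp: nb_weight_Suc)
  also have "\<dots> = (\<Sum>x\<in>nb_walks H (Suc k) i. \<Sum>w\<in>?N x.
          nb_weight H (Suc k) x / (real (deg H (x (Suc k))) - 1) * g (x (Suc k)) w)"
    using fin by (subst sum.Sigma) (auto intro!: finite_nb_walks assms)
  also have "\<dots> = (\<Sum>x\<in>nb_walks H (Suc k) i. nb_weight H (Suc k) x * nb_mean H g (x k) (x (Suc k)))"
    by (intro sum.cong refl) (simp add: nb_mean_def sum_distrib_left sum_divide_distrib)
  finally show ?case by (simp add: Suc.IH funpow_swap1)
qed

lemma friendship_bias_eq_local_bias:
  assumes "finite (verts H)" "wf_graph H" "i \<in> verts H" "k \<ge> 1"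
  shows "friendship_bias ex k H i = local_bias ex k (H, i)"
proof (cases ex)
  case Backtracking
  then show ?thesis using matrix_power_transition[OF assms(1,2,3)] by (simp add: friendship_bias_def)
next
  case NonBacktracking
  let ?W = "nb_walks H k i"
  have "(\<Sum>j\<in>verts H. nb_kernel H k i j * real (deg H j))
      = (\<Sum>j\<in>verts H. \<Sum>x | x \<in> ?W \<and> x k = j. nb_weight H k x * real (deg H (x k)))"
    unfolding nb_kernel_def sum_distrib_right
    by (intro sum.cong refl) (auto simp: nb_walks_def nb_weight_def)
  also have "\<dots> = (\<Sum>x\<in>?W. nb_weight H k x * real (deg H (x k)))"
    using finite_nb_walks[OF assms(1)] assms(1)
    by (intro sum.group) (auto simp: nb_walks_def PiE_def Pi_def)
  finally show ?thesis
    using sum_nb_walks[OF assms(1,2,3), of "k - 1" "\<lambda>_ v. real (deg H v)"] assms(4) NonBacktracking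
    by (simp add: friendship_bias_def)
qed

lemma friendship_bias_component:
  assumes "finite (verts H)" "wf_graph H" "i \<in> verts H" "k \<ge> 1"
  shows "friendship_bias ex k H i = local_bias_class ex k (component H i)"
proof -
  have "finite (neighbours H v)" for v
    using neighbours_verts[OF assms(2)] assms(1) finite_subset by blast
  then have "locally_finite H" by (simp add: locally_finite_def)
  then have "rooted_graph (induced H {v. (i, v) \<in> (adj H)\<^sup>*}, i)"
    by (intro component_rooted_graph assms)
  then show ?thesis
    by (simp add: component_def local_bias_class.abs_eq local_bias_component[OF assms(4)]
        friendship_bias_eq_local_bias[OF assms])
qed

section \<open>Limit trees\<close>

text \<open>
  Loops of a walk are cut out, always keeping the part from the last visit on.
\<close>

lemma rtrancl_distinct_path:
  assumes "(a, b) \<in> R\<^sup>*"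
  obtains p where "p \<noteq> []" "hd p = a" "last p = b" "distinct p" "\<And>i. Suc i < length p \<Longrightarrow> (p ! i, p ! Suc i) \<in> R"
proof -
  have "\<exists>p. p \<noteq> [] \<and> hd p = a \<and> last p = b \<and> distinct p \<and> successively (\<lambda>x y. (x, y) \<in> R) p"
    using assms
  proof (induction rule: converse_rtrancl_induct)
    case base
    show ?case by (intro exI[of _ "[b]"]) auto
  next
    case (step a c)
    then obtain p where p: "p \<noteq> []" "hd p = c" "last p = b" "distinct p" "successively (\<lambda>x y. (x, y) \<in> R) p"
      by blast
    show ?case
    proof (cases "a \<in> set p")
      case True
      then obtain q r where "p = q @ a # r" by (meson split_list)
      then show ?thesis using p by (intro exI[of _ "a # r"]) (auto simp: successively_append_iff)
    next
      case False
      then show ?thesis using p step(1) by (intro exI[of _ "a # p"]) (cases p, auto)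
    qed
  qed
  then show ?thesis using that by (auto simp: successively_conv_nth)
qed

text \<open>
  In an acyclic graph every edge is a bridge: a path between its ends that avoids it would close up
  to a cycle. The path has at least three vertices since it is not the edge itself.
\<close>

lemma no_detour_if_acyclic:
  assumes acyclic: "\<nexists>c. is_cycle H c" and lf: "loop_free H" and sym: "sym (adj H)"
    and e: "(a, b) \<in> adj H" and detour: "(a, b) \<in> (adj H - {(a, b), (b, a)})\<^sup>*"
  shows False
proof -
  obtain p where p: "p \<noteq> []" "hd p = a" "last p = b" "distinct p"
    and s: "\<And>i. Suc i < length p \<Longrightarrow> (p ! i, p ! Suc i) \<in> adj H - {(a, b), (b, a)}"
    using rtrancl_distinct_path[OF detour] by metis
  have ab: "a \<noteq> b" using e lf by (auto simp: adj_def loop_free_def)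
  have ends: "p ! 0 = a" "p ! (length p - 1) = b" using p by (auto simp: hd_conv_nth last_conv_nth)
  have "length p \<noteq> 0" "length p \<noteq> 1" using p(1) ends ab by auto
  moreover have "length p \<noteq> 2" using s[of 0] ends by auto
  ultimately have len: "length p \<ge> 3" by linarith
  have "(p ! i, p ! (Suc i mod length p)) \<in> adj H" if "i < length p" for i
  proof (cases "Suc i < length p")
    case True
    then show ?thesis using s[of i] by simp
  next
    case False
    then have "i = length p - 1" "Suc i = length p" using that by auto
    then show ?thesis using ends symD[OF sym e] by simp
  qed
  then have "is_cycle H p" using len p(4) by (auto simp: is_cycle_def)
  then show False using acyclic by blast
qed

lemma gdist_adj:
  assumes "(v, w) \<in> adj H" shows "gdist H u w \<le> gdist H u v + 1"
proof (cases "gdist H u v")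
  case (enat d)
  then have "gdist H u v \<le> enat d" by simp
  then obtain m where m: "m \<le> d" "(u, v) \<in> adj H ^^ m" unfolding gdist_le_iff by blast
  then have "Suc m \<le> Suc d" "(u, w) \<in> adj H ^^ Suc m" using assms by auto
  then have "gdist H u w \<le> enat (Suc d)" unfolding gdist_le_iff by blast
  then show ?thesis using enat by (simp add: eSuc_enat[symmetric] plus_1_eSuc)
qed simp

lemma gdist_pred:
  assumes "gdist H u w = enat (Suc d)"
  obtains v where "(v, w) \<in> adj H" "gdist H u v = enat d"
proof -
  have "gdist H u w \<le> enat (Suc d)" using assms by simp
  then obtain m where m: "m \<le> Suc d" "(u, w) \<in> adj H ^^ m" unfolding gdist_le_iff by blast
  have "\<not> gdist H u w \<le> enat d" using assms by simp
  then have "m = Suc d" using m unfolding gdist_le_iff by (metis le_SucE)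
  then obtain v where v: "(u, v) \<in> adj H ^^ d" "(v, w) \<in> adj H" using m by auto
  have "gdist H u v \<le> enat d" unfolding gdist_le_iff using v by blast
  moreover have "enat (Suc d) \<le> gdist H u v + 1" using gdist_adj[OF v(2), of u] assms by simp
  ultimately have "gdist H u v = enat d"
    by (cases "gdist H u v") (auto simp: one_enat_def)
  then show ?thesis using v(2) that by blast
qed

text \<open>
  In a tree every vertex except the root has exactly one neighbour that is not further away from
  the root. If \<open>v\<close> had besides \<open>u\<close> another such neighbour \<open>w\<close>, the geodesics from the root to \<open>u\<close> and to \<open>w\<close> would give
  a detour for the edge between \<open>v\<close> and \<open>w\<close>.
\<close>

lemma tree_neighbour_of_child:
  assumes wf: "wf_graph H" and acyclic: "\<nexists>c. is_cycle H c" and lf: "loop_free H"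
    and uv: "(u, v) \<in> adj H" and d: "gdist H r u = enat d" "gdist H r v = enat (Suc d)"
    and vw: "(v, w) \<in> adj H" "w \<noteq> u"
  shows "gdist H r w = enat (Suc (Suc d))"
proof (rule ccontr)
  assume neq: "gdist H r w \<noteq> enat (Suc (Suc d))"
  have sym: "sym (adj H)" by (rule sym_adj[OF wf])
  have "gdist H r w \<le> enat (Suc (Suc d))" using gdist_adj[OF vw(1), of r] d by (simp add: one_enat_def)
  then have dw: "gdist H r w \<le> enat (Suc d)"
    using neq by (cases "gdist H r w") auto
  have wv: "w \<noteq> v" using vw lf by (auto simp: adj_def loop_free_def)
  define R where "R = adj H - {(v, w), (w, v)}"
  have symR: "sym R" using sym unfolding R_def sym_def by blast
  \<comment> \<open>A geodesic to a vertex no deeper than \<open>v\<close> meets \<open>v\<close> only if it ends there.\<close>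
  have reach: "gdist H r x = enat n \<Longrightarrow> n \<le> Suc d \<Longrightarrow> x \<noteq> v \<Longrightarrow> (r, x) \<in> R\<^sup>*" for n x
  proof (induction n arbitrary: x)
    case 0
    then have "gdist H r x \<le> enat 0" by simp
    then have "x = r" unfolding gdist_le_iff by auto
    then show ?case by simp
  next
    case (Suc n)
    obtain y where y: "(y, x) \<in> adj H" "gdist H r y = enat n" using gdist_pred[OF Suc.prems(1)] .
    have "y \<noteq> v" using y d(2) Suc.prems(2) by auto
    then have "(r, y) \<in> R\<^sup>*" "(y, x) \<in> R" using Suc y by (auto simp: R_def)
    then show ?case by simp
  qed
  have "u \<noteq> v" using d by auto
  then have "(r, u) \<in> R\<^sup>*" using reach d(1) by simp
  moreover have "(u, v) \<in> R" using uv vw(2) wv \<open>u \<noteq> v\<close> by (auto simp: R_def)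
  moreover obtain n where "gdist H r w = enat n" "n \<le> Suc d" using dw by (cases "gdist H r w") auto
  then have "(r, w) \<in> R\<^sup>*" using reach wv by blast
  ultimately have "(v, w) \<in> R\<^sup>*"
    using sym_rtrancl[OF symR] by (meson rtrancl_trans rtrancl_into_rtrancl symD)
  then show False
    using no_detour_if_acyclic[OF acyclic lf sym vw(1)] unfolding R_def by blast
qed

lemma deg_simple:
  assumes "simple_graph H" shows "deg H v = card (neighbours H v)"
proof -
  have "nedges H v w = 1" if "w \<in> neighbours H v" for w
    using assms that by (auto simp: simple_graph_def neighbours_def adj_def intro: le_antisym)
  then show ?thesis by (simp add: deg_def)
qed

lemma gdist_root_neighbour:
  assumes "loop_free H" "w \<in> neighbours H r" shows "gdist H r w = 1"
proof -
  have "(r, w) \<in> adj H" using assms(2) by (simp add: neighbours_def)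
  then have le: "gdist H r w \<le> 1" using gdist_adj[of r w H r] by simp
  have "r \<noteq> w" using assms by (auto simp: neighbours_def adj_def loop_free_def)
  then have "\<not> gdist H r w \<le> enat 0" unfolding gdist_le_iff by simp
  then show ?thesis using le by (cases "gdist H r w") (auto simp: one_enat_def)
qed

text \<open>
  Moving to a random offspring is the non-backtracking step: the offspring of \<open>v\<close> are all its
  neighbours except the parent \<open>u\<close>, and there are \<open>deg v - 1\<close> of them.
\<close>

lemma step_mean_tree:
  assumes X: "rooted_graph X" and t: "is_tree (fst X)"
    and off: "\<And>v. v \<in> verts (fst X) \<Longrightarrow> offspring X v \<noteq> {}"
  shows "(u, v) \<in> adj (fst X) \<Longrightarrow> gdist (fst X) (snd X) u = enat d \<Longrightarrow>
     gdist (fst X) (snd X) v = enat (Suc d) \<Longrightarrow>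
     (step_mean NonBacktracking X ^^ m) (\<lambda>v. real (deg (fst X) v)) v
       = (nb_mean (fst X) ^^ m) (\<lambda>_ v. real (deg (fst X) v)) u v"
proof (induction m arbitrary: u v d)
  case (Suc m)
  let ?H = "fst X"
  have wf: "wf_graph ?H" "finite (neighbours ?H v)" using X by (auto simp: rooted_graph_def locally_finite_def)
  have tree: "\<nexists>c. is_cycle ?H c" "loop_free ?H" "simple_graph ?H"
    using t by (auto simp: is_tree_def simple_graph_def)
  have next_gen: "gdist ?H (snd X) w = enat (Suc (Suc d))" if "w \<in> neighbours ?H v - {u}" for w
    using tree_neighbour_of_child[OF wf(1) tree(1,2) Suc.prems, of w] that by (auto simp: neighbours_def)
  have offv: "offspring X v = neighbours ?H v - {u}"
    using next_gen Suc.prems by (auto simp: offspring_def one_enat_def)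
  have u: "u \<in> neighbours ?H v" using symD[OF sym_adj[OF wf(1)] Suc.prems(1)] by (simp add: neighbours_def)
  have "v \<in> verts ?H" using wf_adj[OF wf(1) Suc.prems(1)] by simp
  then have ne: "neighbours ?H v - {u} \<noteq> {}" using off offv by blast
  have "0 < card (neighbours ?H v)" using u wf(2) by (auto simp: card_gt_0_iff)
  then have "real (card (neighbours ?H v - {u})) = real (deg ?H v) - 1"
    using u wf(2) by (simp add: deg_simple[OF tree(3)] of_nat_diff)
  moreover have "(\<Sum>w\<in>neighbours ?H v - {u}. (step_mean NonBacktracking X ^^ m) (\<lambda>v. real (deg ?H v)) w)
      = (\<Sum>w\<in>neighbours ?H v - {u}. (nb_mean ?H ^^ m) (\<lambda>_ v. real (deg ?H v)) v w)"
    by (intro sum.cong refl Suc.IH[OF _ Suc.prems(3) next_gen]) (auto simp: neighbours_def)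
  moreover have "step_mean NonBacktracking X g v = (\<Sum>w\<in>neighbours ?H v - {u}. g w)
      / real (card (neighbours ?H v - {u}))" for g
    using ne by (simp add: step_mean_def offv)
  ultimately show ?case
    by (simp only: funpow.simps comp_apply nb_mean_def[of ?H _ u v])
qed simp

lemma connected_neighbours:
  assumes "wf_graph H" "connected_graph H" "r \<in> verts H" "verts H \<noteq> {r}" "v \<in> verts H"
  shows "neighbours H v \<noteq> {}"
proof -
  obtain w where "w \<in> verts H" "w \<noteq> v" using assms by blast
  then have "(v, w) \<in> (adj H)\<^sup>*" "v \<noteq> w" using assms by (auto simp: connected_graph_def)
  then obtain z where "(v, z) \<in> adj H" by (meson converse_rtranclE)
  then show ?thesis by (auto simp: neighbours_def)
qed

text \<open>
  At the root all neighbours are offspring, which is the separate first step of \<open>local_bias\<close>; trees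
  being simple, degrees count neighbours and edge multiplicities drop out.
\<close>

lemma root_bias_rep_tree:
  assumes X: "rooted_graph X" and t: "admissible_tree ex X" and k: "k \<ge> 1"
  shows "root_bias_rep ex k X = local_bias ex k X"
proof -
  let ?H = "fst X" and ?r = "snd X"
  have wf: "wf_graph ?H" "connected_graph ?H" "?r \<in> verts ?H" "\<And>v. finite (neighbours ?H v)"
    using X by (auto simp: rooted_graph_def locally_finite_def)
  have tree: "is_tree ?H" "loop_free ?H" "simple_graph ?H" using t by (cases ex; auto simp: is_tree_def simple_graph_def)+
  show ?thesis
  proof (cases ex)
    case NonBacktracking
    have ne: "offspring X v \<noteq> {}" if "v \<in> verts ?H" for v using t NonBacktracking that by simp
    have offr: "offspring X ?r = neighbours ?H ?r"
      using gdist_root_neighbour[OF tree(2)] by (auto simp: offspring_def)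
    have "(step_mean NonBacktracking X ^^ (k - 1)) (\<lambda>v. real (deg ?H v)) w
       = (nb_mean ?H ^^ (k - 1)) (\<lambda>_ v. real (deg ?H v)) ?r w" if "w \<in> neighbours ?H ?r" for w
      using that gdist_root_neighbour[OF tree(2) that]
      by (intro step_mean_tree[OF X tree(1) ne]) (auto simp: neighbours_def zero_enat_def one_enat_def)
    moreover have "(step_mean NonBacktracking X ^^ k) (\<lambda>v. real (deg ?H v)) ?r
       = step_mean NonBacktracking X ((step_mean NonBacktracking X ^^ (k - 1)) (\<lambda>v. real (deg ?H v))) ?r"
      using k by (cases k) auto
    moreover have "offspring X ?r \<noteq> {}" using ne wf(3) .
    ultimately show ?thesis
      using NonBacktracking by (simp add: root_bias_rep_eq[OF X] step_mean_def offr deg_simple[OF tree(3)])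
  next
    case Backtracking
    have ne: "neighbours ?H v \<noteq> {}" if "v \<in> verts ?H" for v
      using t Backtracking connected_neighbours[OF wf(1,2,3) _ that] by simp
    have step: "step_mean Backtracking X g v = bt_mean ?H g v" if "v \<in> verts ?H" for g v
    proof -
      have "nedges ?H v w = 1" if "w \<in> neighbours ?H v" for w
        using tree(3) that by (auto simp: simple_graph_def neighbours_def adj_def intro: le_antisym)
      then show ?thesis
        using ne[OF that] by (simp add: step_mean_def bt_mean_def deg_simple[OF tree(3)] sum_divide_distrib)
    qed
    have "(step_mean Backtracking X ^^ m) g v = (bt_mean ?H ^^ m) g v" if "v \<in> verts ?H" for g v m
      using that
    proof (induction m arbitrary: v)
      case (Suc m)
      have "w \<in> verts ?H" if "w \<in> neighbours ?H v" for w using neighbours_verts[OF wf(1)] that by blast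
      then have "bt_mean ?H ((step_mean Backtracking X ^^ m) g) v = bt_mean ?H ((bt_mean ?H ^^ m) g) v"
        using Suc.IH by (subst (1 2) bt_mean_def) (auto intro!: sum.cong)
      then show ?case using step[OF Suc.prems] by simp
    qed simp
    then show ?thesis using Backtracking wf(3) by (simp add: root_bias_rep_eq[OF X])
  qed
qed

lemma root_bias_limit_tree:
  assumes "k \<ge> 1" shows "limit_tree ex x \<Longrightarrow> root_bias ex k x = local_bias_class ex k x"
  using assms by transfer (auto intro: root_bias_rep_tree)

section \<open>Laws of the bias\<close>

lemma borel_measurable_locally_constant:
  fixes h :: "rgraph \<Rightarrow> real"
  assumes "\<And>x y. dist x y < 1 / (1 + real r) \<Longrightarrow> h x = h y"
  shows "h \<in> borel_measurable borel"
  using continuous_on_if_locally_constant[OF assms] by (rule borel_measurable_continuous_onI)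

lemma measurable_root_bias [measurable]: "root_bias ex k \<in> borel_measurable borel"
  by (rule borel_measurable_locally_constant[OF root_bias_locally_constant])

lemma measurable_local_bias_class: "k \<ge> 1 \<Longrightarrow> local_bias_class ex k \<in> borel_measurable borel"
  by (rule borel_measurable_locally_constant[OF local_bias_class_locally_constant])

text \<open>
  The root bias of the limit equals the local bias almost surely, so it may be replaced by it under
  the integral.
\<close>

lemma integral_limit_bias_law:
  fixes f :: "real \<Rightarrow> real"
  assumes L: "limit_law ex \<Lambda>" and k: "k \<ge> 1" and f [measurable]: "f \<in> borel_measurable borel"
  shows "integral\<^sup>L (limit_bias_law ex k \<Lambda>) f = (\<integral>x. f (local_bias_class ex k x) \<partial>\<Lambda>)"
proof -
  have s [measurable_cong]: "sets \<Lambda> = sets borel" and ae: "AE x in \<Lambda>. limit_tree ex x"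
    using L by (auto simp: limit_law_def)
  note measurable_local_bias_class[OF k, measurable]
  have "integral\<^sup>L (limit_bias_law ex k \<Lambda>) f = (\<integral>x. f (root_bias ex k x) \<partial>\<Lambda>)"
    unfolding limit_bias_law_def by (rule integral_distr) measurable
  also have "\<dots> = (\<integral>x. f (local_bias_class ex k x) \<partial>\<Lambda>)"
  proof (rule integral_cong_AE)
    show "AE x in \<Lambda>. f (root_bias ex k x) = f (local_bias_class ex k x)"
      using ae by eventually_elim (simp add: root_bias_limit_tree[OF k])
  qed measurable
  finally show ?thesis .
qed

lemma measure_limit_bias_law:
  assumes "sets \<nu> = sets borel" "A \<in> sets borel"
  shows "measure (limit_bias_law ex k \<nu>) A = measure \<nu> (root_bias ex k -` A)"
proof -
  have "root_bias ex k \<in> \<nu> \<rightarrow>\<^sub>M borel"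
    using measurable_root_bias assms(1) measurable_cong_sets by blast
  moreover have "space \<nu> = UNIV" using sets_eq_imp_space_eq[OF assms(1)] by simp
  ultimately show ?thesis using assms(2) by (simp add: limit_bias_law_def measure_distr)
qed

text \<open>
  The empirical distribution is the law of the bias at a uniformly chosen vertex. This also shows
  that the set function in its definition is a measure.
\<close>

lemma quenched_eq_distr:
  assumes "n \<ge> 1"
  shows "quenched ex k n H = distr (measure_pmf (pmf_of_set {1..n})) borel (friendship_bias ex k H)"
    (is "_ = ?D")
proof -
  have "?D = measure_of UNIV (sets borel) (emeasure ?D)"
    using measure_of_of_measure[of ?D] by simp
  also have "\<dots> = quenched ex k n H"
    unfolding quenched_def
  proof (rule measure_of_eq)
    fix A :: "real set" assume "A \<in> sigma_sets UNIV (sets borel)"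
    then have A: "A \<in> sets borel" using sets.sigma_sets_eq[of "borel :: real measure"] by simp
    have "emeasure ?D A = (\<integral>\<^sup>+x. indicator A x \<partial>?D)" using A by simp
    also have "\<dots> = (\<integral>\<^sup>+i. indicator A (friendship_bias ex k H i) \<partial>measure_pmf (pmf_of_set {1..n}))"
      using A by (intro nn_integral_distr) auto
    also have "\<dots> = (\<Sum>i\<in>{1..n}. indicator A (friendship_bias ex k H i)) / of_nat n"
      using assms by (subst nn_integral_pmf_of_set) auto
    finally show "emeasure ?D A
        = (\<Sum>i\<in>{1..n}. emeasure (return borel (friendship_bias ex k H i)) A) / of_nat n"
      using A by simp
  qed simp
  finally show ?thesis ..
qed

lemma quenched_in_prob_algebra: "n \<ge> 1 \<Longrightarrow> quenched ex k n H \<in> space (prob_algebra borel)"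
  by (simp add: quenched_eq_distr space_prob_algebra measure_pmf.prob_space_distr)

lemma integral_quenched:
  assumes "wf_graph H" "verts H = {1..n}" "n \<ge> 1" "k \<ge> 1" and f: "f \<in> borel_measurable borel"
  shows "integral\<^sup>L (quenched ex k n H) f
    = (\<Sum>i\<in>{1..n}. f (local_bias_class ex k (component H i))) / real n"
proof -
  have "integral\<^sup>L (quenched ex k n H) f
      = (\<integral>i. f (friendship_bias ex k H i) \<partial>measure_pmf (pmf_of_set {1..n}))"
    unfolding quenched_eq_distr[OF assms(3)] by (rule integral_distr) (use f in auto)
  also have "\<dots> = (\<Sum>i\<in>{1..n}. f (friendship_bias ex k H i)) / real n"
    using assms(3) by (subst integral_pmf_of_set) auto
  also have "(\<Sum>i\<in>{1..n}. f (friendship_bias ex k H i))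
      = (\<Sum>i\<in>{1..n}. f (local_bias_class ex k (component H i)))"
    using assms by (intro sum.cong refl arg_cong[where f = f] friendship_bias_component) auto
  finally show ?thesis .
qed

text \<open>
  Multigraphs on \<open>n\<close> labelled vertices are countably many, so that every function of a random graph is
  measurable as soon as the edge multiplicities are.
\<close>

definition graphs_on :: "nat \<Rightarrow> nat mgraph set" where
  "graphs_on n = {H. wf_graph H \<and> verts H = {1..n}}"

lemma graphs_on_eqI:
  assumes "H \<in> graphs_on n" "K \<in> graphs_on n"
    and "\<And>i j. i \<in> {1..n} \<Longrightarrow> j \<in> {1..n} \<Longrightarrow> nedges H i j = nedges K i j"
  shows "H = K"
proof -
  have z: "nedges L i j = 0" if "L \<in> graphs_on n" "i \<notin> {1..n} \<or> j \<notin> {1..n}" for L i j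
    using wf_adj[of L i j] that by (auto simp: graphs_on_def adj_def)
  have "nedges H i j = nedges K i j" for i j
    using assms(3)[of i j] z[OF assms(1), of i j] z[OF assms(2), of i j]
    by (cases "i \<in> {1..n} \<and> j \<in> {1..n}") auto
  then show ?thesis using assms(1,2) by (intro mgraph.equality) (auto simp: graphs_on_def fun_eq_iff)
qed

lemma countable_graphs_on: "countable (graphs_on n)"
proof -
  define c where "c H = restrict (\<lambda>(i, j). nedges H i j) ({1..n} \<times> {1..n})" for H :: "nat mgraph"
  have "inj_on c (graphs_on n)"
  proof (rule inj_onI)
    fix H K assume HK: "H \<in> graphs_on n" "K \<in> graphs_on n" "c H = c K"
    have "c L (i, j) = nedges L i j" if "i \<in> {1..n}" "j \<in> {1..n}" for L i j
      using that by (simp add: c_def)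
    then have "nedges H i j = nedges K i j" if "i \<in> {1..n}" "j \<in> {1..n}" for i j
      using HK(3) that by metis
    then show "H = K" by (intro graphs_on_eqI[OF HK(1,2)])
  qed
  moreover have "countable (c ` graphs_on n)"
  proof (rule countable_subset)
    show "c ` graphs_on n \<subseteq> ({1..n} \<times> {1..n}) \<rightarrow>\<^sub>E UNIV"
      unfolding c_def by (intro image_subsetI) (simp only: restrict_PiE_iff, simp)
  qed (intro countable_PiE; simp)
  ultimately show ?thesis by (metis countable_image_inj_on)
qed

lemma random_graph_measurable:
  assumes "random_graph ex n M G"
  shows "G \<in> M \<rightarrow>\<^sub>M count_space (graphs_on n)"
proof (unfold measurable_count_space_eq_countable[OF countable_graphs_on], intro conjI ballI)
  show GM: "G \<in> space M \<rightarrow> graphs_on n"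
    using assms by (auto simp: random_graph_def graphs_on_def)
  fix H assume H: "H \<in> graphs_on n"
  have "G -` {H} \<inter> space M
      = {\<omega>\<in>space M. \<forall>i\<in>{1..n}. \<forall>j\<in>{1..n}. nedges (G \<omega>) i j = nedges H i j}"
    using GM by (auto intro!: graphs_on_eqI[OF funcset_mem[OF GM] H])
  also have "\<dots> \<in> sets M"
  proof (intro sets.sets_Collect_finite_All)
    fix i j assume "i \<in> {1..n}" "j \<in> {1..n}"
    then have "(\<lambda>\<omega>. nedges (G \<omega>) i j) \<in> M \<rightarrow>\<^sub>M count_space UNIV"
      using assms by (simp add: random_graph_def)
    then show "{\<omega> \<in> space M. nedges (G \<omega>) i j = nedges H i j} \<in> sets M" by measurable
  qed auto
  finally show "G -` {H} \<inter> space M \<in> sets M" .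
qed

lemma random_graph_comp_measurable:
  assumes "random_graph ex n M G" "\<And>H. H \<in> graphs_on n \<Longrightarrow> \<phi> H \<in> space N"
  shows "(\<lambda>\<omega>. \<phi> (G \<omega>)) \<in> M \<rightarrow>\<^sub>M N"
  by (rule measurable_compose[OF random_graph_measurable[OF assms(1)]]) (use assms(2) in auto)

text \<open>
  The monadic bind supplies both that the set function in the definition is a measure and how to
  integrate against it.
\<close>

lemma annealed_eq_bind:
  assumes G: "random_graph ex n M G" and n: "n \<ge> 1"
  shows "annealed ex k n M G = M \<bind> (\<lambda>\<omega>. quenched ex k n (G \<omega>))" (is "_ = ?B")
proof -
  have M: "M \<in> space (prob_algebra M)" using G by (simp add: random_graph_def space_prob_algebra)
  have Q: "(\<lambda>\<omega>. quenched ex k n (G \<omega>)) \<in> M \<rightarrow>\<^sub>M prob_algebra borel"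
    by (rule random_graph_comp_measurable[OF G quenched_in_prob_algebra[OF n]])
  have s: "sets ?B = sets borel" by (rule sets_bind'[OF M Q])
  then have "?B = measure_of UNIV (sets borel) (emeasure ?B)"
    using measure_of_of_measure[of ?B] sets_eq_imp_space_eq[OF s] by simp
  also have "\<dots> = annealed ex k n M G"
    unfolding annealed_def
  proof (rule measure_of_eq)
    fix A :: "real set" assume "A \<in> sigma_sets UNIV (sets borel)"
    then have A: "A \<in> sets borel" using sets.sigma_sets_eq[of "borel :: real measure"] by simp
    show "emeasure ?B A = (\<integral>\<^sup>+\<omega>. emeasure (quenched ex k n (G \<omega>)) A \<partial>M)"
      by (rule emeasure_bind_prob_algebra[OF M Q A])
  qed simp
  finally show ?thesis ..
qed

lemma integral_annealed:
  fixes f :: "real \<Rightarrow> real" and B :: real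
  assumes G: "random_graph ex n M G" and n: "n \<ge> 1"
    and f: "f \<in> borel_measurable borel" "\<And>x. \<bar>f x\<bar> \<le> B"
  shows "integral\<^sup>L (annealed ex k n M G) f = (\<integral>\<omega>. integral\<^sup>L (quenched ex k n (G \<omega>)) f \<partial>M)"
proof -
  have Q: "(\<lambda>\<omega>. quenched ex k n (G \<omega>)) \<in> M \<rightarrow>\<^sub>M prob_algebra borel"
    by (rule random_graph_comp_measurable[OF G quenched_in_prob_algebra[OF n]])
  have "prob_space M" using G by (simp add: random_graph_def)
  then have "finite_measure M" by (simp add: prob_space.finite_measure)
  moreover have "AE \<omega> in M. emeasure (quenched ex k n (G \<omega>)) (space (quenched ex k n (G \<omega>))) \<le> ennreal 1"
    using quenched_in_prob_algebra[OF n] by (simp add: space_prob_algebra prob_space.emeasure_space_1)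
  moreover have "\<bar>f x\<bar> \<le> B" if "x \<in> space borel" for x by (rule f(2))
  ultimately show ?thesis
    unfolding annealed_eq_bind[OF G n]
    by (intro integral_bind[OF f(1) _ measurable_prob_algebraD[OF Q]])
qed

section \<open>Convergence\<close>

text \<open>
  Bounded convergence: outside the set where the difference exceeds \<open>e / 2\<close> the integrals differ by at
  most \<open>e / 2\<close>, and on this set by at most its probability.
\<close>

lemma expectation_tendsto_if_in_prob:
  assumes conv: "converges_in_prob M X Y"
    and P: "\<And>n. n \<ge> N \<Longrightarrow> prob_space (M n)"
    and X: "\<And>n. n \<ge> N \<Longrightarrow> X n \<in> borel_measurable (M n)"
    and Y: "\<And>n. n \<ge> N \<Longrightarrow> Y n \<in> borel_measurable (M n)"
    and bX: "\<And>n \<omega>. n \<ge> N \<Longrightarrow> \<omega> \<in> space (M n) \<Longrightarrow> X n \<omega> \<in> {0..1}"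
    and bY: "\<And>n \<omega>. n \<ge> N \<Longrightarrow> \<omega> \<in> space (M n) \<Longrightarrow> Y n \<omega> \<in> {0..1}"
  shows "(\<lambda>n. (\<integral>\<omega>. X n \<omega> \<partial>M n) - (\<integral>\<omega>. Y n \<omega> \<partial>M n)) \<longlonglongrightarrow> 0"
proof (rule LIMSEQ_I)
  fix e :: real assume e: "e > 0"
  let ?B = "\<lambda>n. {\<omega> \<in> space (M n). \<bar>X n \<omega> - Y n \<omega>\<bar> > e / 2}"
  have "(\<lambda>n. measure (M n) (?B n)) \<longlonglongrightarrow> 0"
    using conv half_gt_zero[OF e] unfolding converges_in_prob_def by blast
  then have "\<forall>\<^sub>F n in sequentially. measure (M n) (?B n) < e / 2"
    using e by (intro order_tendstoD) auto
  moreover have "\<forall>\<^sub>F n in sequentially. n \<ge> N" by (rule eventually_ge_at_top)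
  ultimately have "\<forall>\<^sub>F n in sequentially. norm ((\<integral>\<omega>. X n \<omega> \<partial>M n) - (\<integral>\<omega>. Y n \<omega> \<partial>M n) - 0) < e"
  proof eventually_elim
    case (elim n)
    interpret prob_space "M n" by (rule P[OF elim(2)])
    note [measurable] = X[OF elim(2)] Y[OF elim(2)]
    have B: "?B n \<in> sets (M n)" by measurable
    have bound_B: "integrable (M n) (\<lambda>\<omega>. e / 2 + indicator S \<omega>)"
      "(\<integral>\<omega>. e / 2 + indicator S \<omega> \<partial>M n) = e / 2 + measure (M n) S" if "S \<in> sets (M n)" for S
    proof -
      have "integrable (M n) (indicator S :: _ \<Rightarrow> real)"
        by (rule integrable_real_indicator[OF that]) (simp add: emeasure_eq_measure)
      then show "integrable (M n) (\<lambda>\<omega>. e / 2 + indicator S \<omega>)"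
        "(\<integral>\<omega>. e / 2 + indicator S \<omega> \<partial>M n) = e / 2 + measure (M n) S"
        using that by (simp_all add: prob_space)
    qed
    have iX: "integrable (M n) (X n)" and iY: "integrable (M n) (Y n)"
      using bX[OF elim(2)] bY[OF elim(2)] by (auto intro!: integrable_const_bound[where B = 1])
    have "norm ((\<integral>\<omega>. X n \<omega> \<partial>M n) - (\<integral>\<omega>. Y n \<omega> \<partial>M n)) = norm (\<integral>\<omega>. X n \<omega> - Y n \<omega> \<partial>M n)"
      using iX iY by simp
    also have "\<dots> \<le> (\<integral>\<omega>. \<bar>X n \<omega> - Y n \<omega>\<bar> \<partial>M n)"
      using integral_norm_bound[of "M n" "\<lambda>\<omega>. X n \<omega> - Y n \<omega>"] by simp
    also have "\<dots> \<le> (\<integral>\<omega>. e / 2 + indicator (?B n) \<omega> \<partial>M n)"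
    proof (rule integral_mono)
      show "integrable (M n) (\<lambda>\<omega>. \<bar>X n \<omega> - Y n \<omega>\<bar>)" using iX iY by simp
      show "integrable (M n) (\<lambda>\<omega>. e / 2 + indicator (?B n) \<omega>)" by (rule bound_B(1)[OF B])
      fix \<omega> assume w: "\<omega> \<in> space (M n)"
      then show "\<bar>X n \<omega> - Y n \<omega>\<bar> \<le> e / 2 + indicator (?B n) \<omega>"
        using bX[OF elim(2) w] bY[OF elim(2) w] e by (auto simp: indicator_def)
    qed
    also have "\<dots> = e / 2 + measure (M n) (?B n)"
      by (rule bound_B(2)[OF B])
    also have "\<dots> < e" using elim(1) by simp
    finally show ?case by simp
  qed
  then show "\<exists>n0. \<forall>n\<ge>n0. norm ((\<integral>\<omega>. X n \<omega> \<partial>M n) - (\<integral>\<omega>. Y n \<omega> \<partial>M n) - 0) < e"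
    unfolding eventually_sequentially .
qed

text \<open>
  Both integrals equal those in the definition of local convergence for the test function
  \<open>f \<circ> local_bias_class ex k\<close>, the second one only almost surely. The exceptional event on the left may
  be non-measurable, in which case its \<open>measure\<close> is 0; the event on the right is
  measurable, so monotonicity of \<open>measure\<close> up to null sets applies in either case.
\<close>

lemma quenched_converges_in_prob:
  assumes k: "k \<ge> 1" and n0: "n0 \<ge> 1"
    and G: "\<And>n. n \<ge> n0 \<Longrightarrow> random_graph ex n (M n) (G n)"
    and meas: "\<And>n. n \<ge> n0 \<Longrightarrow> \<Lambda> n \<in> M n \<rightarrow>\<^sub>M prob_algebra borel"
    and ae: "\<And>n. n \<ge> n0 \<Longrightarrow> AE \<omega> in M n. limit_law ex (\<Lambda> n \<omega>)"
    and conv: "converges_locally_in_prob M G \<Lambda>"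
    and f: "f \<in> borel_measurable borel" "bounded (range f)"
  shows "converges_in_prob M (\<lambda>n \<omega>. integral\<^sup>L (quenched ex k n (G n \<omega>)) f)
    (\<lambda>n \<omega>. integral\<^sup>L (limit_bias_law ex k (\<Lambda> n \<omega>)) f)"
  unfolding converges_in_prob_def
proof (intro allI impI)
  fix e :: real assume e: "e > 0"
  define h where "h x = f (local_bias_class ex k x)" for x
  have cont: "continuous_on UNIV h" unfolding h_def by (rule continuous_on_local_bias_comp[OF k])
  have "bounded (range h)" using f(2) by (rule bounded_subset) (auto simp: h_def)
  let ?X = "\<lambda>n \<omega>. (\<Sum>i\<in>{1..n}. h (component (G n \<omega>) i)) / real n"
  let ?B = "\<lambda>n. {\<omega> \<in> space (M n). \<bar>?X n \<omega> - integral\<^sup>L (\<Lambda> n \<omega>) h\<bar> > e}"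
  let ?A = "\<lambda>n. {\<omega> \<in> space (M n). \<bar>integral\<^sup>L (quenched ex k n (G n \<omega>)) f
      - integral\<^sup>L (limit_bias_law ex k (\<Lambda> n \<omega>)) f\<bar> > e}"
  have lim: "(\<lambda>n. measure (M n) (?B n)) \<longlonglongrightarrow> 0"
    using conv cont \<open>bounded (range h)\<close> e
    unfolding converges_locally_in_prob_def converges_in_prob_def by blast
  have le: "measure (M n) (?A n) \<le> measure (M n) (?B n)" if n: "n \<ge> n0" for n
  proof -
    interpret prob_space "M n" using G[OF n] by (simp add: random_graph_def)
    have [measurable]: "?X n \<in> borel_measurable (M n)"
      by (rule random_graph_comp_measurable[OF G[OF n], where \<phi> = "\<lambda>H. (\<Sum>i\<in>{1..n}. h (component H i)) / real n"]) simp
    have "h \<in> borel_measurable borel" by (rule borel_measurable_continuous_onI[OF cont])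
    then have [measurable]: "(\<lambda>\<omega>. integral\<^sup>L (\<Lambda> n \<omega>) h) \<in> borel_measurable (M n)"
      using measurable_compose[OF measurable_prob_algebraD[OF meas[OF n]] integral_measurable_subprob_algebra] by blast
    have "?B n \<in> sets (M n)" by measurable
    moreover have "AE \<omega> in M n. \<omega> \<in> ?A n \<longrightarrow> \<omega> \<in> ?B n"
      using ae[OF n]
    proof (rule AE_mp, intro AE_I2 impI)
      fix \<omega> assume w: "\<omega> \<in> space (M n)" "limit_law ex (\<Lambda> n \<omega>)" "\<omega> \<in> ?A n"
      have "wf_graph (G n \<omega>)" "verts (G n \<omega>) = {1..n}"
        using G[OF n] w(1) by (auto simp: random_graph_def)
      then have "integral\<^sup>L (quenched ex k n (G n \<omega>)) f = ?X n \<omega>"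
        unfolding h_def using n n0 by (intro integral_quenched k f(1)) auto
      moreover have "integral\<^sup>L (limit_bias_law ex k (\<Lambda> n \<omega>)) f = integral\<^sup>L (\<Lambda> n \<omega>) h"
        unfolding h_def by (rule integral_limit_bias_law[OF w(2) k f(1)])
      ultimately show "\<omega> \<in> ?B n" using w(3) by simp
    qed
    ultimately show ?thesis by (intro finite_measure_mono_AE)
  qed
  show "(\<lambda>n. measure (M n) (?A n)) \<longlonglongrightarrow> 0"
    by (rule Lim_null_comparison[OF eventually_sequentiallyI[of n0] lim]) (use le in simp)
qed

lemma integral_indicator_quenched:
  assumes "n \<ge> 1" "A \<in> sets borel"
  shows "integral\<^sup>L (quenched ex k n H) (indicator A) = measure (quenched ex k n H) A"
  using assms by (simp add: quenched_eq_distr)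

lemma integral_indicator_limit_bias_law:
  assumes "A \<in> sets borel"
  shows "integral\<^sup>L (limit_bias_law ex k \<nu>) (indicator A) = measure (limit_bias_law ex k \<nu>) A"
  using assms by (simp add: limit_bias_law_def)

lemma integral_indicator_annealed:
  assumes "A \<in> sets borel"
  shows "integral\<^sup>L (annealed ex k n M G) (indicator A) = measure (annealed ex k n M G) A"
  by (simp add: annealed_def)

lemma bounded_indicator: "bounded (range (indicator A :: 'a \<Rightarrow> real))"
  by (intro boundedI[where B = 1]) (auto simp: indicator_def)

lemma measure_annealed:
  assumes G: "random_graph ex n M G" and n: "n \<ge> 1" and A: "A \<in> sets borel"
  shows "measure (annealed ex k n M G) A = (\<integral>\<omega>. measure (quenched ex k n (G \<omega>)) A \<partial>M)"
proof -
  have m: "(indicator A :: real \<Rightarrow> real) \<in> borel_measurable borel" using A by simp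
  have b: "\<bar>indicator A x :: real\<bar> \<le> 1" for x by (simp add: indicator_def)
  from integral_annealed[OF G n m b] show ?thesis
    unfolding integral_indicator_annealed[OF A] integral_indicator_quenched[OF n A] .
qed

text \<open>
  The law \<open>\<Lambda>\<close> may depend on the realisation, so the expected mass of \<open>A\<close> under the limit may still
  vary with \<open>n\<close>; therefore the annealed statement is about a difference. For a deterministic law and
  for versions with the same distribution, the subtracted integral does not depend on \<open>n\<close>.
\<close>

lemma convergence_in_prob:
  assumes k: "k \<ge> 1" and n0: "n0 \<ge> 1"
    and G: "\<And>n. n \<ge> n0 \<Longrightarrow> random_graph ex n (M n) (G n)"
    and meas: "\<And>n. n \<ge> n0 \<Longrightarrow> \<Lambda> n \<in> M n \<rightarrow>\<^sub>M prob_algebra borel"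
    and ae: "\<And>n. n \<ge> n0 \<Longrightarrow> AE \<omega> in M n. limit_law ex (\<Lambda> n \<omega>)"
    and conv: "converges_locally_in_prob M G \<Lambda>"
  shows "weakly_converges_in_prob M (\<lambda>n \<omega>. quenched ex k n (G n \<omega>)) (\<lambda>n \<omega>. limit_bias_law ex k (\<Lambda> n \<omega>))"
    and "A \<in> sets borel \<Longrightarrow> converges_in_prob M (\<lambda>n \<omega>. measure (quenched ex k n (G n \<omega>)) A)
            (\<lambda>n \<omega>. measure (limit_bias_law ex k (\<Lambda> n \<omega>)) A)"
    and "A \<in> sets borel \<Longrightarrow> (\<lambda>n. measure (annealed ex k n (M n) (G n)) A
            - (\<integral>\<omega>. measure (limit_bias_law ex k (\<Lambda> n \<omega>)) A \<partial>M n)) \<longlonglongrightarrow> 0"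
proof -
  have conv_f: "converges_in_prob M (\<lambda>n \<omega>. integral\<^sup>L (quenched ex k n (G n \<omega>)) f)
      (\<lambda>n \<omega>. integral\<^sup>L (limit_bias_law ex k (\<Lambda> n \<omega>)) f)"
    if "f \<in> borel_measurable borel" "bounded (range f)" for f :: "real \<Rightarrow> real"
    by (rule quenched_converges_in_prob[OF k n0 G meas ae conv that])
  show "weakly_converges_in_prob M (\<lambda>n \<omega>. quenched ex k n (G n \<omega>)) (\<lambda>n \<omega>. limit_bias_law ex k (\<Lambda> n \<omega>))"
    unfolding weakly_converges_in_prob_def
    by (intro allI impI conv_f) (auto intro: borel_measurable_continuous_onI)
  assume A: "A \<in> sets borel"
  let ?X = "\<lambda>n \<omega>. measure (quenched ex k n (G n \<omega>)) A"
  let ?Y = "\<lambda>n \<omega>. measure (limit_bias_law ex k (\<Lambda> n \<omega>)) A"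
  have "indicator A \<in> borel_measurable borel" using A by simp
  from conv_f[OF this bounded_indicator]
  have "converges_in_prob M (\<lambda>n \<omega>. integral\<^sup>L (quenched ex k n (G n \<omega>)) (indicator A)) ?Y"
    unfolding integral_indicator_limit_bias_law[OF A] .
  moreover have "\<forall>\<^sub>F n in sequentially. \<forall>\<omega>. integral\<^sup>L (quenched ex k n (G n \<omega>)) (indicator A) = ?X n \<omega>"
    using integral_indicator_quenched[OF _ A] by (intro eventually_sequentiallyI[of 1]) auto
  ultimately show XY: "converges_in_prob M ?X ?Y"
    unfolding converges_in_prob_def
    by (auto elim!: tendsto_cong[THEN iffD1, rotated] eventually_mono)
  have sets: "sets (\<Lambda> n \<omega>) = sets borel" "prob_space (\<Lambda> n \<omega>)" if "n \<ge> n0" "\<omega> \<in> space (M n)" for n \<omega>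
    using measurable_space[OF meas that(2)] that(1) by (auto simp: space_prob_algebra)
  have "(\<lambda>n. (\<integral>\<omega>. ?X n \<omega> \<partial>M n) - (\<integral>\<omega>. ?Y n \<omega> \<partial>M n)) \<longlonglongrightarrow> 0"
  proof (rule expectation_tendsto_if_in_prob[OF XY, of n0])
    fix n assume n: "n \<ge> n0"
    then have n1: "n \<ge> 1" using n0 by simp
    show "prob_space (M n)" using G[OF n] by (simp add: random_graph_def)
    show "?X n \<in> borel_measurable (M n)"
      by (rule random_graph_comp_measurable[OF G[OF n]]) simp
    have "(\<lambda>\<omega>. measure (\<Lambda> n \<omega>) (root_bias ex k -` A)) \<in> borel_measurable (M n)"
      using measurable_sets[OF measurable_root_bias A, of ex k]
      by (intro measurable_compose[OF meas[OF n] measurable_measure_prob_algebra]) simp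
    then show "?Y n \<in> borel_measurable (M n)"
      using measure_limit_bias_law[OF sets(1)[OF n] A]
      by (subst measurable_cong) auto
    fix \<omega> assume w: "\<omega> \<in> space (M n)"
    interpret L: prob_space "\<Lambda> n \<omega>" by (rule sets(2)[OF n w])
    show "?Y n \<omega> \<in> {0..1}" by (simp add: measure_limit_bias_law[OF sets(1)[OF n w] A])
    interpret Q: prob_space "quenched ex k n (G n \<omega>)"
      using quenched_in_prob_algebra[OF n1] by (simp add: space_prob_algebra)
    show "?X n \<omega> \<in> {0..1}" by simp
  qed
  moreover have "\<forall>\<^sub>F n in sequentially. (\<integral>\<omega>. ?X n \<omega> \<partial>M n) = measure (annealed ex k n (M n) (G n)) A"
    using measure_annealed[OF G _ A] n0 by (intro eventually_sequentiallyI[of n0]) auto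
  ultimately show "(\<lambda>n. measure (annealed ex k n (M n) (G n)) A - (\<integral>\<omega>. ?Y n \<omega> \<partial>M n)) \<longlonglongrightarrow> 0"
    by (auto elim!: tendsto_cong[THEN iffD1, rotated] eventually_mono)
qed

text \<open>
  Local weak convergence speaks of expectations of averages over vertices, and these are integrals
  with respect to the annealed law.
\<close>

lemma annealed_converges:
  fixes f :: "real \<Rightarrow> real"
  assumes k: "k \<ge> 1" and n0: "n0 \<ge> 1"
    and G: "\<And>n. n \<ge> n0 \<Longrightarrow> random_graph ex n (M n) (G n)"
    and L: "limit_law ex \<Lambda>" and conv: "converges_locally_weakly M G \<Lambda>"
    and f: "f \<in> borel_measurable borel" "bounded (range f)"
  shows "(\<lambda>n. integral\<^sup>L (annealed ex k n (M n) (G n)) f) \<longlonglongrightarrow> integral\<^sup>L (limit_bias_law ex k \<Lambda>) f"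
proof -
  define h where "h x = f (local_bias_class ex k x)" for x
  have cont: "continuous_on UNIV h" unfolding h_def by (rule continuous_on_local_bias_comp[OF k])
  have "bounded (range h)" using f(2) by (rule bounded_subset) (auto simp: h_def)
  then have "(\<lambda>n. \<integral>\<omega>. (\<Sum>i\<in>{1..n}. h (component (G n \<omega>) i)) / real n \<partial>M n) \<longlonglongrightarrow> integral\<^sup>L \<Lambda> h"
    using conv cont unfolding converges_locally_weakly_def by blast
  moreover have "integral\<^sup>L \<Lambda> h = integral\<^sup>L (limit_bias_law ex k \<Lambda>) f"
    unfolding h_def by (rule integral_limit_bias_law[OF L k f(1), symmetric])
  moreover have "(\<integral>\<omega>. (\<Sum>i\<in>{1..n}. h (component (G n \<omega>) i)) / real n \<partial>M n)
      = integral\<^sup>L (annealed ex k n (M n) (G n)) f" if n: "n \<ge> n0" for n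
  proof -
    obtain B where "\<And>x. \<bar>f x\<bar> \<le> B" using f(2) by (auto simp: bounded_iff)
    moreover have n1: "n \<ge> 1" using n n0 by simp
    ultimately have "integral\<^sup>L (annealed ex k n (M n) (G n)) f
        = (\<integral>\<omega>. integral\<^sup>L (quenched ex k n (G n \<omega>)) f \<partial>M n)"
      by (intro integral_annealed[OF G[OF n] _ f(1)])
    also have "\<dots> = (\<integral>\<omega>. (\<Sum>i\<in>{1..n}. h (component (G n \<omega>) i)) / real n \<partial>M n)"
      unfolding h_def using G[OF n] n1
      by (intro Bochner_Integration.integral_cong refl integral_quenched k f(1)) (auto simp: random_graph_def)
    finally show ?thesis ..
  qed
  then have "\<forall>\<^sub>F n in sequentially. (\<integral>\<omega>. (\<Sum>i\<in>{1..n}. h (component (G n \<omega>) i)) / real n \<partial>M n)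
      = integral\<^sup>L (annealed ex k n (M n) (G n)) f"
    by (rule eventually_sequentiallyI)
  ultimately show ?thesis by (auto elim!: tendsto_cong[THEN iffD1, rotated])
qed

lemma min_order_pos: "min_order ex \<ge> 1"
  by (cases ex) auto

theorem theorem3p2:
  fixes ex :: exploration and k :: nat
    and M :: "nat \<Rightarrow> 'w measure" and G :: "nat \<Rightarrow> 'w \<Rightarrow> nat mgraph"
  assumes "k \<ge> 1"
    and "\<And>n. n \<ge> min_order ex \<Longrightarrow> random_graph ex n (M n) (G n)"
  shows
    "(\<forall>\<Lambda>. limit_law ex \<Lambda> \<and> converges_locally_in_prob M G (\<lambda>_ _. \<Lambda>) \<longrightarrow>
        weakly_converges_in_prob M (\<lambda>n \<omega>. quenched ex k n (G n \<omega>)) (\<lambda>_ _. limit_bias_law ex k \<Lambda>) \<and>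
        (\<forall>A\<in>sets borel.
          converges_in_prob M (\<lambda>n \<omega>. measure (quenched ex k n (G n \<omega>)) A)
            (\<lambda>_ _. measure (limit_bias_law ex k \<Lambda>) A) \<and>
          (\<lambda>n. measure (annealed ex k n (M n) (G n)) A) \<longlonglongrightarrow> measure (limit_bias_law ex k \<Lambda>) A))
    \<and>
     (\<forall>\<Lambda> L. random_limit_law ex M \<Lambda> L \<and> converges_locally_in_prob M G \<Lambda> \<longrightarrow>
        weakly_converges_in_prob M (\<lambda>n \<omega>. quenched ex k n (G n \<omega>))
          (\<lambda>n \<omega>. limit_bias_law ex k (\<Lambda> n \<omega>)) \<and>
        (\<forall>A\<in>sets borel.
          converges_in_prob M (\<lambda>n \<omega>. measure (quenched ex k n (G n \<omega>)) A)
            (\<lambda>n \<omega>. measure (limit_bias_law ex k (\<Lambda> n \<omega>)) A) \<and>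
          (\<lambda>n. measure (annealed ex k n (M n) (G n)) A)
            \<longlonglongrightarrow> (\<integral>\<nu>. measure (limit_bias_law ex k \<nu>) A \<partial>L)))
    \<and>
     (\<forall>\<Lambda>. limit_law ex \<Lambda> \<and> converges_locally_weakly M G \<Lambda> \<longrightarrow>
        weakly_converges (\<lambda>n. annealed ex k n (M n) (G n)) (limit_bias_law ex k \<Lambda>) \<and>
        (\<forall>A\<in>sets borel.
          (\<lambda>n. measure (annealed ex k n (M n) (G n)) A) \<longlonglongrightarrow> measure (limit_bias_law ex k \<Lambda>) A))"
proof (intro conjI allI impI)
  have P: "prob_space (M n)" if "n \<ge> min_order ex" for n
    using assms(2)[OF that] by (simp add: random_graph_def)
  have difference_limit: "(\<lambda>n. a n) \<longlonglongrightarrow> l"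
    if "(\<lambda>n. a n - b n) \<longlonglongrightarrow> 0" "\<And>n. n \<ge> min_order ex \<Longrightarrow> b n = l" for a b :: "nat \<Rightarrow> real" and l
  proof -
    have "b \<longlonglongrightarrow> l" using that(2) by (intro tendsto_eventually eventually_sequentiallyI)
    from tendsto_add[OF that(1) this] show ?thesis by simp
  qed
  {
    fix \<Lambda> assume *: "limit_law ex \<Lambda> \<and> converges_locally_in_prob M G (\<lambda>_ _. \<Lambda>)"
    have "\<Lambda> \<in> space (prob_algebra borel)" using * by (simp add: limit_law_def space_prob_algebra)
    then have meas: "(\<lambda>_. \<Lambda>) \<in> M n \<rightarrow>\<^sub>M prob_algebra borel" for n by simp
    have ae: "AE \<omega> in M n. limit_law ex \<Lambda>" for n using * by simp
    show "weakly_converges_in_prob M (\<lambda>n \<omega>. quenched ex k n (G n \<omega>)) (\<lambda>_ _. limit_bias_law ex k \<Lambda>)"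
      by (rule convergence_in_prob(1)[OF assms(1) min_order_pos assms(2) meas ae conjunct2[OF *]])
    show "\<forall>A\<in>sets borel. converges_in_prob M (\<lambda>n \<omega>. measure (quenched ex k n (G n \<omega>)) A)
            (\<lambda>_ _. measure (limit_bias_law ex k \<Lambda>) A) \<and>
          (\<lambda>n. measure (annealed ex k n (M n) (G n)) A) \<longlonglongrightarrow> measure (limit_bias_law ex k \<Lambda>) A"
    proof (intro ballI conjI)
      fix A :: "real set" assume A: "A \<in> sets borel"
      show "converges_in_prob M (\<lambda>n \<omega>. measure (quenched ex k n (G n \<omega>)) A)
            (\<lambda>_ _. measure (limit_bias_law ex k \<Lambda>) A)"
        by (rule convergence_in_prob(2)[OF assms(1) min_order_pos assms(2) meas ae conjunct2[OF *] A])
      have "(\<lambda>n. measure (annealed ex k n (M n) (G n)) A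
            - (\<integral>\<omega>. measure (limit_bias_law ex k \<Lambda>) A \<partial>M n)) \<longlonglongrightarrow> 0"
        by (rule convergence_in_prob(3)[OF assms(1) min_order_pos assms(2) meas ae conjunct2[OF *] A])
      then show "(\<lambda>n. measure (annealed ex k n (M n) (G n)) A) \<longlonglongrightarrow> measure (limit_bias_law ex k \<Lambda>) A"
        by (rule difference_limit) (simp add: prob_space.prob_space[OF P])
    qed
  }
  {
    fix \<Lambda> L assume *: "random_limit_law ex M \<Lambda> L \<and> converges_locally_in_prob M G \<Lambda>"
    then have meas: "\<Lambda> n \<in> M n \<rightarrow>\<^sub>M prob_algebra borel" and L: "L = distr (M n) (prob_algebra borel) (\<Lambda> n)"
      if "n \<ge> min_order ex" for n using that by (auto simp: random_limit_law_def)
    have "AE \<nu> in L. limit_law ex \<nu>" using * by (simp add: random_limit_law_def)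
    then have ae: "AE \<omega> in M n. limit_law ex (\<Lambda> n \<omega>)" if "n \<ge> min_order ex" for n
      unfolding L[OF that] by (rule AE_distrD[OF meas[OF that]])
    show "weakly_converges_in_prob M (\<lambda>n \<omega>. quenched ex k n (G n \<omega>)) (\<lambda>n \<omega>. limit_bias_law ex k (\<Lambda> n \<omega>))"
      by (rule convergence_in_prob(1)[OF assms(1) min_order_pos assms(2) meas ae conjunct2[OF *]])
    show "\<forall>A\<in>sets borel. converges_in_prob M (\<lambda>n \<omega>. measure (quenched ex k n (G n \<omega>)) A)
            (\<lambda>n \<omega>. measure (limit_bias_law ex k (\<Lambda> n \<omega>)) A) \<and>
          (\<lambda>n. measure (annealed ex k n (M n) (G n)) A)
            \<longlonglongrightarrow> (\<integral>\<nu>. measure (limit_bias_law ex k \<nu>) A \<partial>L)"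
    proof (intro ballI conjI)
      fix A :: "real set" assume A: "A \<in> sets borel"
      show "converges_in_prob M (\<lambda>n \<omega>. measure (quenched ex k n (G n \<omega>)) A)
            (\<lambda>n \<omega>. measure (limit_bias_law ex k (\<Lambda> n \<omega>)) A)"
        by (rule convergence_in_prob(2)[OF assms(1) min_order_pos assms(2) meas ae conjunct2[OF *] A])
      have "(\<lambda>\<nu>. measure \<nu> (root_bias ex k -` A)) \<in> borel_measurable (prob_algebra borel)"
        using measurable_sets[OF measurable_root_bias A, of ex k]
        by (intro measurable_measure_prob_algebra) simp
      then have "(\<lambda>\<nu>. measure (limit_bias_law ex k \<nu>) A) \<in> borel_measurable (prob_algebra borel)"
        by (subst measurable_cong[OF measure_limit_bias_law[OF _ A]]) (auto simp: space_prob_algebra)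
      then have Y: "(\<integral>\<omega>. measure (limit_bias_law ex k (\<Lambda> n \<omega>)) A \<partial>M n)
          = (\<integral>\<nu>. measure (limit_bias_law ex k \<nu>) A \<partial>L)" if "n \<ge> min_order ex" for n
        unfolding L[OF that] by (intro integral_distr[symmetric] meas that)
      have "(\<lambda>n. measure (annealed ex k n (M n) (G n)) A
            - (\<integral>\<omega>. measure (limit_bias_law ex k (\<Lambda> n \<omega>)) A \<partial>M n)) \<longlonglongrightarrow> 0"
        by (rule convergence_in_prob(3)[OF assms(1) min_order_pos assms(2) meas ae conjunct2[OF *] A])
      then show "(\<lambda>n. measure (annealed ex k n (M n) (G n)) A)
            \<longlonglongrightarrow> (\<integral>\<nu>. measure (limit_bias_law ex k \<nu>) A \<partial>L)"
        by (rule difference_limit) (rule Y)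
    qed
  }
  {
    fix \<Lambda> assume *: "limit_law ex \<Lambda> \<and> converges_locally_weakly M G \<Lambda>"
    have conv: "(\<lambda>n. integral\<^sup>L (annealed ex k n (M n) (G n)) f) \<longlonglongrightarrow> integral\<^sup>L (limit_bias_law ex k \<Lambda>) f"
      if "f \<in> borel_measurable borel" "bounded (range f)" for f :: "real \<Rightarrow> real"
      by (rule annealed_converges[OF assms(1) min_order_pos assms(2) conjunct1[OF *] conjunct2[OF *] that])
    show "weakly_converges (\<lambda>n. annealed ex k n (M n) (G n)) (limit_bias_law ex k \<Lambda>)"
      unfolding weakly_converges_def
      by (intro allI impI conv) (auto intro: borel_measurable_continuous_onI)
    show "\<forall>A\<in>sets borel. (\<lambda>n. measure (annealed ex k n (M n) (G n)) A) \<longlonglongrightarrow> measure (limit_bias_law ex k \<Lambda>) A"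
    proof
      fix A :: "real set" assume A: "A \<in> sets borel"
      then have "indicator A \<in> borel_measurable borel" by simp
      from conv[OF this bounded_indicator]
      show "(\<lambda>n. measure (annealed ex k n (M n) (G n)) A) \<longlonglongrightarrow> measure (limit_bias_law ex k \<Lambda>) A"
        unfolding integral_indicator_annealed[OF A] integral_indicator_limit_bias_law[OF A] .
    qed
  }
qed

end
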